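(* For $1\leq p<\infty$ and $-1<a<p-1$, $$A_{p,a}^p=\begin{cases} \frac{1+a}{-a} & \text{if } p=1,\\ \bigl(\frac{1+a}{p-1-a}\bigr)^p & \text{if } 1<p\leq 2,\ \ p-1-p^{\frac{p-2}{p-1}}\leq a<p-1,\\ k_{p,a}(\alpha_0,1) & \text{if } 1<p\leq 2,\ \ p-2<a<p-1-p^{\frac{p-2}{p-1}},\\ \frac{1+a}{p-1-a} & \text{if } 1<p\leq 2,\ \ -1<a\leq p-2,\\ \bigl(\frac{1+a}{p-1-a}\bigr)^p & \text{if } p>2,\ \ p^{\frac{p-2}{p-1}}-1\leq a<p-1,\\ k_{p,a}(0,\beta_0) & \text{if } p>2,\ \ 0<a<p^{\frac{p-2}{p-1}}-1,\\ \frac{1+a}{p-1-a} & \text{if } p>2,\ \ -1<a\leq 0. \end{cases}$$ Here: for $1<p<2$ and $p-2<a<p-1-p^{\frac{p-2}{p-1}}$, $\alpha_0=\alpha_0(p,a)$ is the unique solution of the equation $$-(p-1)(1-\alpha_0)+1+a-(1+a)\alpha_0^{p-1}=0$$ in the interval $(0,(p-1-a)/p)$; for $p>2$ and $0<a<p^{\frac{p-2}{p-1}}-1$, $\beta_0=\beta_0(p,a)$ is the unique solution of the equation $$-(p-1-a)(1-\beta_0)^{p-1}-(p-1)\beta_0+p-1-a=0$$ in the interval $((p-1-a)/p,1)$. (The existence and uniqueness of these solutions is part of the assertion.)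
   Context: For a locally integrable $f\colon[0,\infty)\to\mathbb{R}$ the Hardy operator is $Hf(t)=\frac1t\int_0^t f(s)\,ds$, $t>0$. For $1\le p<\infty$ and $-1<a<p-1$, $A_{p,a}$ denotes the smallest constant $K$ such that $$\int_0^\infty|Hf(t)-f(t)|^p t^a\,dt\le K^p\int_0^\infty|f(t)|^pt^a\,dt$$ for all positive and decreasing functions $f$ on the half-line for which the right-hand side is finite. Here "positive" means $f\ge 0$ and "decreasing" means non-increasing on $(0,\infty)$ (the value at $t=0$ is irrelevant; $f$ may be unbounded near $0$). For $\alpha<\frac{p-1-a}{p}<\beta$, $$k_{p,a}(\alpha,\beta)=\frac{(\beta-\frac{p-1-a}{p})|\alpha-1|^p+(\frac{p-1-a}{p}-\alpha)|\beta-1|^p}{(\beta-\frac{p-1-a}{p})|\alpha|^p+(\frac{p-1-a}{p}-\alpha)|\beta|^p}.$$ For $p=2$ the third case in the formula is vacuous. *)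

theory Defs
  imports "HOL-Analysis.Analysis"
begin

definition hardy_op :: "(real \<Rightarrow> real) \<Rightarrow> real \<Rightarrow> real" where
  "hardy_op f t = (1 / t) * (LINT s:{0..t}|lborel. f s)"

(* The values are extended nonnegative reals, so divergent integrals are equal to \<infinity>. *)
definition weighted_int :: "real \<Rightarrow> real \<Rightarrow> (real \<Rightarrow> real) \<Rightarrow> ennreal" where
  "weighted_int p a g = (\<integral>\<^sup>+t\<in>{0<..}. ennreal (\<bar>g t\<bar> powr p * t powr a) \<partial>lborel)"

(* Functions on the half-line are functions on the reals; only their values on (0, \<infinity>)
   matter.  "Positive" means nonnegative, "decreasing" means non-increasing.

   Local integrability on [0, \<infinity>) is not listed because it follows when 1 \<le> p and
   -1 < a < p - 1:  monotonicity gives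
     f(x)^p * x^(a+1) / (a+1) \<le> (integral of f(t)^p * t^a over (0, x)),
   so f(x) \<le> C * x^(-(a+1)/p) with (a+1)/p < 1.  Hence the Lebesgue integral in hardy_op
   is the true one, not the default value 0, for all functions of this class. *)
definition hardy_class :: "real \<Rightarrow> real \<Rightarrow> (real \<Rightarrow> real) set" where
  "hardy_class p a =
     {f. (\<forall>t>0. 0 \<le> f t) \<and> antimono_on {0<..} f \<and> weighted_int p a f < \<infinity>}"

definition hardy_bound :: "real \<Rightarrow> real \<Rightarrow> real \<Rightarrow> bool" where
  "hardy_bound p a K \<longleftrightarrow> 0 \<le> K \<and>
     (\<forall>f\<in>hardy_class p a.
        weighted_int p a (\<lambda>t. hardy_op f t - f t) \<le> ennreal (K powr p) * weighted_int p a f)"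

definition hardy_const :: "real \<Rightarrow> real \<Rightarrow> real" where
  "hardy_const p a = (LEAST K. hardy_bound p a K)"

definition kfun :: "real \<Rightarrow> real \<Rightarrow> real \<Rightarrow> real \<Rightarrow> real" where
  "kfun p a \<alpha> \<beta> =
     ((\<beta> - (p - 1 - a) / p) * \<bar>\<alpha> - 1\<bar> powr p + ((p - 1 - a) / p - \<alpha>) * \<bar>\<beta> - 1\<bar> powr p) /
     ((\<beta> - (p - 1 - a) / p) * \<bar>\<alpha>\<bar> powr p + ((p - 1 - a) / p - \<alpha>) * \<bar>\<beta>\<bar> powr p)"

definition is_alpha0 :: "real \<Rightarrow> real \<Rightarrow> real \<Rightarrow> bool" where
  "is_alpha0 p a \<alpha> \<longleftrightarrow> \<alpha> \<in> {0<..<(p - 1 - a) / p} \<and>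
     - (p - 1) * (1 - \<alpha>) + 1 + a - (1 + a) * \<alpha> powr (p - 1) = 0"

definition alpha0 :: "real \<Rightarrow> real \<Rightarrow> real" where
  "alpha0 p a = (THE \<alpha>. is_alpha0 p a \<alpha>)"

definition is_beta0 :: "real \<Rightarrow> real \<Rightarrow> real \<Rightarrow> bool" where
  "is_beta0 p a \<beta> \<longleftrightarrow> \<beta> \<in> {(p - 1 - a) / p<..<1} \<and>
     - (p - 1 - a) * (1 - \<beta>) powr (p - 1) - (p - 1) * \<beta> + p - 1 - a = 0"

definition beta0 :: "real \<Rightarrow> real \<Rightarrow> real" where
  "beta0 p a = (THE \<beta>. is_beta0 p a \<beta>)"

end

(* With c = (p - 1 - a) / p and h = Hf one has (h^p t^(a+1))' = p t^a h^(p-1) (f - c h), so the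
   integral of t^a h^(p-1) (f - c h) vanishes.  For decreasing f >= 0 the ratio x = f / h lies in
   [0, 1]; hence an inequality (1 - x)^p <= M x^p + mu (c - x) on [0, 1] implies A^p <= M.
   Conversely, f(t) = beta t^(beta-1) on (0, 1] and alpha t^(alpha-1) on (1, oo) with
   0 <= alpha < c < beta <= 1 is decreasing, has f / h = beta and then alpha, and gives
   A^p >= k(alpha, beta).  So A^p is the least M for which some line through (c, 0) lies above
   (1 - x)^p - M x^p on [0, 1].  For p <= 2 this function is first concave and then convex, for
   p >= 2 it is the other way round, and the optimal line is the chord over [0, 1], the tangent
   at c, or a tangent through one of the endpoints; these are the cases of the theorem. *)

theory Submission
  imports Defs
begin

section \<open>Lines above $(1-x)^p - M x^p$\<close>

text \<open>Upper and lower bound meet because k(\<alpha>, \<beta>) is exactly the M for which the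
  chord of (1 - x)^p - M x^p over [\<alpha>, \<beta>] passes through (c, 0); the tangent at c is the
  degenerate chord. The inflection point of the curve depends on M and is never located: the signs
  are read off from the derivative of the gap between line and curve, which is concave for p \<le> 2
  and convex for p \<ge> 2. The vanishing of the integral is only formal. It needs a differentiable
  primitive F of f, and boundary terms F^p t^(a+1-p) that disappear. At infinity a sign suffices,
  which is why \<mu> \<ge> 0 is required of the line. At 0 the term tends to 0 if f is bounded
  there, since -1 < a. A function of the class may be discontinuous and unbounded near 0, and this
  forces an approximation.\<close>

lemma powr_concave:
  fixes q :: real
  assumes "0 < q" "q \<le> 1"
  shows "concave_on {0..} (\<lambda>x. x powr q)"
proof -
  have *: "concave_on {0<..} (\<lambda>x. x powr q)"
    by (rule f''_le0_imp_concave derivative_eq_intros refl | use assms in \<open>simp add: mult_nonneg_nonpos2 mult_nonneg_nonpos\<close>)+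
  \<comment> \<open>The second-derivative criterion only covers the open half-line. A segment
    starting at 0 is treated by hand, from v \<le> v powr q on [0, 1].\<close>
  have z: "v * y powr q \<le> (v * y) powr q" if "0 \<le> v" "v \<le> 1" "0 \<le> y" for v y :: real
  proof -
    have "v powr 1 \<le> v powr q"
      using that assms by (intro powr_mono') auto
    then show ?thesis
      using that by (simp add: powr_mult mult_right_mono)
  qed
  show ?thesis
  proof (rule concave_on_linorderI)
    fix t x y :: real
    assume t: "0 < t" "t < 1" and xy: "x \<in> {0..}" "y \<in> {0..}" "x < y"
    show "(1 - t) * x powr q + t * y powr q \<le> ((1 - t) *\<^sub>R x + t *\<^sub>R y) powr q"
    proof (cases "x = 0")
      case True
      then show ?thesis using z[of t y] t xy by simp
    next
      case False
      then show ?thesis using concave_onD[OF *, of t x y] t xy by simp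
    qed
  qed simp
qed

lemma powr_convex_atLeast:
  fixes q :: real
  assumes "1 \<le> q"
  shows "convex_on {0..} (\<lambda>x. x powr q)"
proof -
  have z: "(v * y) powr q \<le> v * y powr q" if "0 \<le> v" "v \<le> 1" "0 \<le> y" for v y :: real
  proof -
    have "v powr q \<le> v powr 1"
      using that assms by (intro powr_mono') auto
    then show ?thesis
      using that by (simp add: powr_mult mult_right_mono)
  qed
  show ?thesis
  proof (rule convex_on_linorderI)
    fix t x y :: real
    assume t: "0 < t" "t < 1" and xy: "x \<in> {0..}" "y \<in> {0..}" "x < y"
    show "((1 - t) *\<^sub>R x + t *\<^sub>R y) powr q \<le> (1 - t) * x powr q + t * y powr q"
    proof (cases "x = 0")
      case True
      then show ?thesis using z[of t y] t xy by simp
    next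
      case False
      then show ?thesis using convex_onD[OF powr_convex[OF assms], of t x y] t xy by simp
    qed
  qed simp
qed

lemma concave_on_reflect:
  fixes g :: "real \<Rightarrow> real"
  assumes "concave_on {0..1} g"
  shows "concave_on {0..1} (\<lambda>x. g (1 - x))"
  unfolding concave_on_iff
proof (intro conjI ballI allI impI)
  fix x y u v :: real
  assume xy: "x \<in> {0..1}" "y \<in> {0..1}" and uv: "0 \<le> u" "0 \<le> v" "u + v = 1"
  have e: "1 - (u *\<^sub>R x + v *\<^sub>R y) = u *\<^sub>R (1 - x) + v *\<^sub>R (1 - y)"
    using uv(3) by (simp add: algebra_simps)
  show "u * g (1 - x) + v * g (1 - y) \<le> g (1 - (u *\<^sub>R x + v *\<^sub>R y))"
    unfolding e using assms xy uv by (auto simp: concave_on_iff)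
qed simp

text \<open>The three-chord inequality with cleared denominators, so that the sign of
  \<open>D\<close> at one point follows from its signs at the other two.\<close>

lemma concave_between:
  fixes D :: "real \<Rightarrow> real"
  assumes D: "concave_on S D" and "x \<in> S" "z \<in> S" and x: "x < y" "y < z"
  shows "(z - y) * D x + (y - x) * D z \<le> (z - x) * D y"
proof -
  define t where "t = (y - x) / (z - x)"
  have t: "0 \<le> t" "t \<le> 1" "1 - t = (z - y) / (z - x)"
    using x by (auto simp: t_def field_simps)
  have y: "(1 - t) *\<^sub>R x + t *\<^sub>R z = y"
  proof -
    have "(z - y) * x + (y - x) * z = y * (z - x)"
      by (simp add: algebra_simps)
    then show ?thesis
      using x unfolding t(3) unfolding t_def by (simp add: add_divide_distrib[symmetric])
  qed
  have "(1 - t) * D x + t * D z \<le> D y"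
    using concave_onD[OF D, of t x z] t assms unfolding y by auto
  then have "((z - y) * D x + (y - x) * D z) / (z - x) \<le> D y"
    unfolding t(3) unfolding t_def by (simp add: add_divide_distrib)
  then show ?thesis
    using x by (simp add: field_simps)
qed

text \<open>No second-order condition at \<open>\<alpha>\<close> is needed: \<open>P \<alpha> \<le> P 1\<close> provides a point to the right
  of \<open>\<alpha>\<close> with \<open>D \<ge> 0\<close>, which by concavity forces \<open>D \<le> 0\<close> on the left of \<open>\<alpha>\<close>.\<close>

lemma nonneg_if_deriv_concave:
  fixes P D :: "real \<Rightarrow> real"
  assumes cont: "continuous_on {0..1} P"
    and der: "\<And>x. 0 < x \<Longrightarrow> x < 1 \<Longrightarrow> (P has_real_derivative D x) (at x)"
    and D: "concave_on {0..1} D"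
    and \<alpha>: "0 \<le> \<alpha>" "\<alpha> < 1" "0 \<le> P \<alpha>" "0 \<le> P 1" "0 \<le> D \<alpha>"
    and left: "0 < \<alpha> \<Longrightarrow> D \<alpha> = 0 \<and> P \<alpha> \<le> P 1"
    and x: "0 \<le> x" "x \<le> 1"
  shows "0 \<le> P x"
proof (rule ccontr)
  assume neg: "\<not> 0 \<le> P x"
  have mvt: "\<exists>z. u < z \<and> z < v \<and> P v - P u = (v - u) * D z" if uv: "0 \<le> u" "u < v" "v \<le> 1" for u v
  proof -
    have "continuous_on {u..v} P"
      using uv by (intro continuous_on_subset[OF cont]) auto
    moreover have "P differentiable (at z)" if "u < z" "z < v" for z
      using der[of z] that uv by (auto simp: real_differentiable_def)
    ultimately obtain l z where z: "u < z" "z < v" "DERIV P z :> l" "P v - P u = (v - u) * l"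
      using MVT[OF \<open>u < v\<close>] by blast
    moreover have "l = D z"
      using DERIV_unique[OF z(3) der[of z]] z uv by auto
    ultimately show ?thesis by blast
  qed
  consider "x < \<alpha>" | "\<alpha> < x" "x < 1"
    using neg \<alpha> x by (cases "x = \<alpha>"; cases "x = 1") force+
  then show False
  proof cases
    case 1
    obtain z where z: "x < z" "z < \<alpha>" "P \<alpha> - P x = (\<alpha> - x) * D z"
      using mvt[of x \<alpha>] 1 \<alpha> x by auto
    have "0 < (\<alpha> - x) * D z" using neg \<alpha> z by linarith
    then have Dz: "D z > 0" using 1 by (simp add: zero_less_mult_iff)
    obtain w where w: "\<alpha> < w" "w < 1" "P 1 - P \<alpha> = (1 - \<alpha>) * D w"
      using mvt[of \<alpha> 1] 1 \<alpha> x by auto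
    have "0 \<le> (1 - \<alpha>) * D w" using left 1 x w by simp
    then have "D w \<ge> 0" using \<alpha> by (simp add: zero_le_mult_iff)
    moreover have "(w - \<alpha>) * D z + (\<alpha> - z) * D w \<le> 0"
      using concave_between[OF D, of z w \<alpha>] left 1 x z w by simp
    ultimately show False
      using Dz z w by (smt (verit) mult_pos_pos mult_nonneg_nonneg)
  next
    \<comment> \<open>A negative value of \<open>P\<close> at x would give \<open>D\<close> a
      negative value between \<alpha> and x and a positive one beyond x. With \<open>D\<close>
      nonnegative at \<alpha> this contradicts concavity.\<close>
    case 2
    obtain y where y: "\<alpha> < y" "y < x" "P x - P \<alpha> = (x - \<alpha>) * D y"
      using mvt[of \<alpha> x] 2 \<alpha> x by auto
    obtain z where z: "x < z" "z < 1" "P 1 - P x = (1 - x) * D z"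
      using mvt[of x 1] 2 \<alpha> x by auto
    have "(x - \<alpha>) * D y < 0" "0 < (1 - x) * D z" using neg \<alpha> y z by linarith+
    then have "D y < 0" "D z > 0" using 2 by (simp_all add: zero_less_mult_iff mult_less_0_iff)
    moreover have "(z - y) * D \<alpha> + (y - \<alpha>) * D z \<le> (z - \<alpha>) * D y"
      using concave_between[OF D, of \<alpha> z y] \<alpha> 2 y z by simp
    ultimately show False
      using \<alpha> y z by (smt (verit) mult_pos_pos mult_nonneg_nonneg mult_pos_neg)
  qed
qed

text \<open>\<open>P\<close> is the height of the line above the curve and \<open>D\<close> its
  derivative, whose two powers are concave because p - 1 \<le> 1. Contact may occur at \<alpha> = 0,
  where only the sign of \<open>D\<close> matters, or inside, where tangency is required; the
  remaining test is at the endpoint 1.\<close>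

lemma powr_line_bound_le2:
  fixes p M \<mu> c \<alpha> :: real
  defines "P \<equiv> \<lambda>x. M * x powr p - (1 - x) powr p + \<mu> * (c - x)"
    and "D \<equiv> \<lambda>x. p * (M * x powr (p - 1) + (1 - x) powr (p - 1)) - \<mu>"
  assumes p: "1 < p" "p \<le> 2" and "0 \<le> M"
    and \<alpha>: "0 \<le> \<alpha>" "\<alpha> < 1" "0 \<le> P \<alpha>" "0 \<le> P 1" "0 \<le> D \<alpha>"
    and left: "0 < \<alpha> \<Longrightarrow> D \<alpha> = 0 \<and> P \<alpha> \<le> P 1"
    and x: "0 \<le> x" "x \<le> 1"
  shows "(1 - x) powr p \<le> M * x powr p + \<mu> * (c - x)"
proof -
  have "0 \<le> P x"
  proof (rule nonneg_if_deriv_concave[of P D \<alpha>])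
    show "continuous_on {0..1} P"
      unfolding P_def using p by (intro continuous_intros continuous_on_powr') auto
    show "(P has_real_derivative D x) (at x)" if "0 < x" "x < 1" for x
      unfolding P_def D_def using that p
      by (auto intro!: derivative_eq_intros simp: algebra_simps)
    have c: "concave_on {0..1} (\<lambda>x. x powr (p - 1))"
      using powr_concave[of "p - 1"] p by (auto simp: concave_on_def intro: convex_on_subset)
    then show "concave_on {0..1} D"
      unfolding D_def using p \<open>0 \<le> M\<close>
      by (intro concave_on_diff concave_on_cmul concave_on_add concave_on_reflect) (auto simp: convex_on_const)
  qed (use \<alpha> left x in auto)
  then show ?thesis by (simp add: P_def)
qed

text \<open>For p \<ge> 2 the powers in \<open>D\<close> are convex. The reflection x -> 1 - x
  reverses the sign of the derivative and so restores concavity. It also swaps the endpoints: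
  contact is at \<beta> and the test is at 0.\<close>

lemma powr_line_bound_ge2:
  fixes p M \<mu> c \<beta> :: real
  defines "P \<equiv> \<lambda>x. M * x powr p - (1 - x) powr p + \<mu> * (c - x)"
    and "D \<equiv> \<lambda>x. p * (M * x powr (p - 1) + (1 - x) powr (p - 1)) - \<mu>"
  assumes p: "2 \<le> p" and "0 \<le> M"
    and \<beta>: "0 < \<beta>" "\<beta> \<le> 1" "0 \<le> P \<beta>" "0 \<le> P 0" "D \<beta> \<le> 0"
    and right: "\<beta> < 1 \<Longrightarrow> D \<beta> = 0 \<and> P \<beta> \<le> P 0"
    and x: "0 \<le> x" "x \<le> 1"
  shows "(1 - x) powr p \<le> M * x powr p + \<mu> * (c - x)"
proof -
  have "0 \<le> P (1 - (1 - x))"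
  proof (rule nonneg_if_deriv_concave[of "\<lambda>x. P (1 - x)" "\<lambda>x. - D (1 - x)" "1 - \<beta>"])
    show "continuous_on {0..1} (\<lambda>x. P (1 - x))"
      unfolding P_def using p by (intro continuous_intros continuous_on_powr') auto
    show "((\<lambda>x. P (1 - x)) has_real_derivative - D (1 - x)) (at x)" if "0 < x" "x < 1" for x
      unfolding P_def D_def using that p
      by (auto intro!: derivative_eq_intros simp: algebra_simps)
    have "convex_on {0..1} (\<lambda>x. x powr (p - 1))"
      using powr_convex_atLeast[of "p - 1"] p by (auto intro: convex_on_subset)
    then have c: "concave_on {0..1} (\<lambda>x. - (x powr (p - 1)))"
      by (simp add: concave_on_def)
    have "concave_on {0..1} (\<lambda>x. p * (M * - (x powr (p - 1)) + - ((1 - x) powr (p - 1))) - (- \<mu>))"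
      using p \<open>0 \<le> M\<close> c concave_on_reflect[OF c]
      by (intro concave_on_diff concave_on_cmul concave_on_add) (auto simp: convex_on_const)
    from concave_on_reflect[OF this] show "concave_on {0..1} (\<lambda>x. - D (1 - x))"
      by (simp add: D_def algebra_simps)
  qed (use \<beta> right x in auto)
  then show ?thesis by (simp add: P_def)
qed

section \<open>The optimal lines: chord, tangent at c, tangent through an endpoint\<close>

lemma powr_split: "0 \<le> x \<Longrightarrow> x powr p = x * x powr (p - 1)" for x p :: real
  by (cases "x = 0") (simp_all add: powr_diff)

text \<open>The line joins the endpoints (0, 1) and (1, -M) of the curve; passing through (c, 0)
  forces \<mu> = 1 / c and M = (1 - c) / c. The derivative of the gap at 0 is p - 1 / c, so 1 / p
  \<le> c is its sign condition.\<close>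

lemma chord_bound_le2:
  fixes p c :: real
  assumes "1 < p" "p \<le> 2" "1 / p \<le> c" "c < 1" "0 \<le> x" "x \<le> 1"
  shows "(1 - x) powr p \<le> (1 - c) / c * x powr p + 1 / c * (c - x)"
proof -
  have "0 < c" using assms by (smt (verit) divide_pos_pos)
  then show ?thesis
    using assms by (intro powr_line_bound_le2[where \<alpha> = 0]) (auto simp: field_simps)
qed

text \<open>The same line, with the derivative tested at 1: it is (p * (1 - c) - 1) / c, and it is
  \<le> 0 exactly when 1 - 1 / p \<le> c.\<close>

lemma chord_bound_ge2:
  fixes p c :: real
  assumes "2 \<le> p" "1 - 1 / p \<le> c" "c < 1" "0 \<le> x" "x \<le> 1"
  shows "(1 - x) powr p \<le> (1 - c) / c * x powr p + 1 / c * (c - x)"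
proof -
  have "1 / p \<le> 1 / 2" using assms by (intro divide_left_mono) auto
  then have c: "0 < c" using assms by linarith
  have "p * (1 - c) \<le> 1"
    using assms by (simp add: field_simps)
  then have "p * (1 - c) / c \<le> 1 / c"
    using c by (intro divide_right_mono) auto
  then show ?thesis
    using assms c by (intro powr_line_bound_ge2[where \<beta> = 1]) (auto simp flip: add_divide_distrib)
qed

text \<open>This M makes the curve vanish at c. The second equation evaluates the negative slope of
  the curve there, which is the \<mu> of the tangent.\<close>

lemma tangent_at_ratio:
  fixes p c :: real
  assumes c: "0 < c" "c < 1"
  shows "((1 - c) / c) powr p * c powr p = (1 - c) powr p"
    and "p * (((1 - c) / c) powr p * c powr (p - 1) + (1 - c) powr (p - 1)) = p * (1 - c) powr (p - 1) / c"
proof -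
  show *: "((1 - c) / c) powr p * c powr p = (1 - c) powr p"
    using c by (simp add: powr_divide)
  have "(((1 - c) / c) powr p * c powr (p - 1) + (1 - c) powr (p - 1)) * c = (1 - c) powr (p - 1)"
    using * powr_split[of c p] powr_split[of "1 - c" p] c by (simp add: algebra_simps)
  then show "p * (((1 - c) / c) powr p * c powr (p - 1) + (1 - c) powr (p - 1)) = p * (1 - c) powr (p - 1) / c"
    using c by (simp add: nonzero_eq_divide_eq)
qed

text \<open>Tangency at c is built into M and \<mu>. What remains is the endpoint 1, where the gap
  is (1 - c)^p * (1 / c^p - p / c); its sign is the hypothesis on
  \<open>c powr (p - 1)\<close>.\<close>

lemma ratio_bound_le2:
  fixes p c :: real
  assumes p: "1 < p" "p \<le> 2" and c: "0 < c" "c < 1" "p * c powr (p - 1) \<le> 1" and "0 \<le> x" "x \<le> 1"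
  shows "(1 - x) powr p \<le> ((1 - c) / c) powr p * x powr p + p * (1 - c) powr (p - 1) / c * (c - x)"
proof -
  have "p * c powr p \<le> c"
    using c powr_split[of c p] mult_left_mono[OF c(3), of c] by (simp add: algebra_simps)
  then have "p / c \<le> 1 / c powr p"
    using c p by (simp add: field_simps)
  then have "(1 - c) powr p * (p / c) \<le> (1 - c) powr p * (1 / c powr p)"
    by (intro mult_left_mono) auto
  then have "0 \<le> ((1 - c) / c) powr p + p * (1 - c) powr (p - 1) / c * (c - 1)"
    using c powr_split[of "1 - c" p] by (simp add: powr_divide) (simp add: algebra_simps diff_divide_distrib add_divide_distrib)
  then show ?thesis
    using assms tangent_at_ratio[OF c(1,2), of p]
    by (intro powr_line_bound_le2[where \<alpha> = c]) auto
qed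

text \<open>Here the test is at the endpoint 0, where the gap is p * (1 - c)^(p - 1) - 1.\<close>

lemma ratio_bound_ge2:
  fixes p c :: real
  assumes p: "2 \<le> p" and c: "0 < c" "c < 1" "1 \<le> p * (1 - c) powr (p - 1)" and "0 \<le> x" "x \<le> 1"
  shows "(1 - x) powr p \<le> ((1 - c) / c) powr p * x powr p + p * (1 - c) powr (p - 1) / c * (c - x)"
  using assms tangent_at_ratio[OF c(1,2), of p]
  by (intro powr_line_bound_ge2[where \<beta> = c]) auto

text \<open>M is k(\<alpha>, 1), so the line meets the curve at \<alpha> and at the endpoint (1,
  -M); the endpoint gives \<mu> = M / (1 - c). The equation \<open>eq\<close> expresses tangency at
  \<alpha>.\<close>

lemma tangent_bound_le2:
  fixes p c \<alpha> :: real
  defines "M \<equiv> (1 - c) * (1 - \<alpha>) powr p / ((1 - c) * \<alpha> powr p + (c - \<alpha>))"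
  assumes p: "1 < p" "p \<le> 2" and \<alpha>: "0 < \<alpha>" "\<alpha> < c" "c < 1"
    and eq: "1 + (p - 1) * \<alpha> - p * c - p * (1 - c) * \<alpha> powr (p - 1) = 0"
    and x: "0 \<le> x" "x \<le> 1"
  shows "(1 - x) powr p \<le> M * x powr p + M / (1 - c) * (c - x)"
proof -
  define A B where "A = \<alpha> powr (p - 1)" and "B = (1 - \<alpha>) powr (p - 1)"
  define N where "N = (1 - c) * (\<alpha> * A) + (c - \<alpha>)"
  have A: "\<alpha> powr p = \<alpha> * A" and B: "(1 - \<alpha>) powr p = (1 - \<alpha>) * B"
    unfolding A_def B_def using \<alpha> by (auto intro: powr_split)
  have N: "0 < N"
    unfolding N_def A_def using \<alpha> by (intro add_nonneg_pos mult_nonneg_nonneg) auto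
  have M: "M * N = (1 - c) * ((1 - \<alpha>) * B)"
    using N by (simp add: M_def A B flip: N_def)
  have M0: "0 \<le> M"
    using N \<alpha> by (simp add: M_def A B flip: N_def) (simp add: B_def)
  define c' where "c' = 1 - c"
  have c': "0 < c'" "c = 1 - c'" using \<alpha> by (auto simp: c'_def)
  have "M * (\<alpha> * A) - (1 - \<alpha>) * B + M / (1 - c) * (c - \<alpha>) = (M * N - (1 - c) * ((1 - \<alpha>) * B)) / (1 - c)"
    using c' by (simp add: N_def field_simps)
  then have P: "M * (\<alpha> * A) - (1 - \<alpha>) * B + M / (1 - c) * (c - \<alpha>) = 0"
    by (simp add: M)
  \<comment> \<open>Replacing the power of 1 - \<alpha> by means of \<open>M * N\<close> turns this
    multiple of the derivative at \<alpha> into -M times the left side of \<open>eq\<close>.\<close>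
  have "(1 - c) * (1 - \<alpha>) * (p * (M * A + B) - M / (1 - c))
        = p * (1 - c) * (1 - \<alpha>) * M * A + p * (M * N) - M * (1 - \<alpha>)"
    using c' by (simp add: M field_simps)
  also have "\<dots> = - M * (1 + (p - 1) * \<alpha> - p * c - p * (1 - c) * A)"
    by (simp add: N_def algebra_simps)
  also have "\<dots> = 0" using eq by (simp add: A_def)
  finally have D: "p * (M * A + B) - M / (1 - c) = 0"
    using \<alpha> by auto
  have P1: "M * 1 powr p - (1 - 1) powr p + M / (1 - c) * (c - 1) = 0"
    using c' by simp
  show ?thesis
    by (rule powr_line_bound_le2[OF p M0, where \<alpha> = \<alpha>]) (use P P1 D \<alpha> x in \<open>auto simp: A B simp flip: A_def B_def\<close>)
qed

text \<open>M is k(0, \<beta>). The line starts at the endpoint (0, 1), hence \<mu> = 1 / c, and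
  \<open>eq\<close> expresses tangency at \<beta>.\<close>

lemma tangent_bound_ge2:
  fixes p c \<beta> :: real
  defines "M \<equiv> (c * (1 - \<beta>) powr p + (\<beta> - c)) / (c * \<beta> powr p)"
  assumes p: "2 \<le> p" and \<beta>: "0 < c" "c < \<beta>" "\<beta> < 1"
    and eq: "p * c * (1 - \<beta>) powr (p - 1) + (p - 1) * \<beta> - p * c = 0"
    and x: "0 \<le> x" "x \<le> 1"
  shows "(1 - x) powr p \<le> M * x powr p + 1 / c * (c - x)"
proof -
  define A B where "A = \<beta> powr (p - 1)" and "B = (1 - \<beta>) powr (p - 1)"
  have A: "\<beta> powr p = \<beta> * A" and B: "(1 - \<beta>) powr p = (1 - \<beta>) * B"
    unfolding A_def B_def using \<beta> by (auto intro: powr_split)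
  have A0: "0 < A" and B0: "0 \<le> B" using \<beta> by (auto simp: A_def B_def)
  have M0: "0 \<le> M"
    using \<beta> A0 B0 by (simp add: M_def A B)
  have M: "c * \<beta> * (M * A) = c * ((1 - \<beta>) * B) + (\<beta> - c)"
    using \<beta> A0 by (simp add: M_def A B)
  have "c * (M * (\<beta> * A) - (1 - \<beta>) * B + 1 / c * (c - \<beta>)) = 0"
    using M \<beta> by (simp add: field_simps)
  then have P: "M * (\<beta> * A) - (1 - \<beta>) * B + 1 / c * (c - \<beta>) = 0"
    using \<beta> by simp
  have "c * \<beta> * (p * (M * A + B) - 1 / c) = p * (c * \<beta> * (M * A)) + p * c * \<beta> * B - \<beta>"
    using \<beta> by (simp add: field_simps)
  also have "\<dots> = p * c * B + (p - 1) * \<beta> - p * c"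
    unfolding M by (simp add: algebra_simps)
  also have "\<dots> = 0" using eq by (simp add: B_def)
  finally have D: "p * (M * A + B) - 1 / c = 0"
    using \<beta> by auto
  have P0: "M * 0 powr p - (1 - 0) powr p + 1 / c * (c - 0) = 0"
    using \<beta> by simp
  show ?thesis
    by (rule powr_line_bound_ge2[OF p M0, where \<beta> = \<beta>]) (use P P0 D \<beta> x in \<open>auto simp: A B simp flip: A_def B_def\<close>)
qed

section \<open>Existence and uniqueness of the tangency points\<close>

text \<open>Outside the interval between two of its zeros a convex function is nonnegative, so two
  interior zeros would make \<open>E\<close> nonnegative at both ends.\<close>

lemma convex_root_unique:
  fixes E :: "real \<Rightarrow> real"
  assumes E: "convex_on {u..v} E" and "x \<in> {u<..<v}" "y \<in> {u<..<v}" "E x = 0" "E y = 0"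
    and sgn: "E u * E v < 0"
  shows "x = y"
proof (rule ccontr)
  assume "x \<noteq> y"
  have key: "(r - q) * E s + (q - s) * E r \<ge> (r - s) * E q"
    if "u \<le> s" "s < q" "q < r" "r \<le> v" for s q r
    using concave_between[of "{u..v}" "\<lambda>x. - E x" s r q] E that by (simp add: concave_on_def)
  have F: False if "x' < y'" "x' \<in> {u<..<v}" "y' \<in> {u<..<v}" "E x' = 0" "E y' = 0" for x' y'
    using key[of u x' y'] key[of x' y' v] sgn that
    by (auto simp: zero_le_mult_iff mult_less_0_iff)
  show False
    using F[of x y] F[of y x] \<open>x \<noteq> y\<close> assms by linarith
qed

text \<open>The last two inequalities in \<open>c\<close> say that the chord criterion and the
  criterion for the tangent at c both fail. They are precisely the signs of \<open>E\<close> at 0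
  and at c.\<close>

lemma alpha_root_ex1:
  fixes p c :: real
  assumes p: "1 < p" "p \<le> 2" and c: "0 < c" "c < 1" "p * c < 1" "1 < p * c powr (p - 1)"
  shows "\<exists>!x. x \<in> {0<..<c} \<and> 1 + (p - 1) * x - p * c - p * (1 - c) * x powr (p - 1) = 0"
proof -
  define E where "E = (\<lambda>x. 1 + (p - 1) * x - p * c - p * (1 - c) * x powr (p - 1))"
  have E0: "E 0 > 0" using c p by (simp add: E_def)
  have "E c = (1 - c) * (1 - p * c powr (p - 1))" by (simp add: E_def algebra_simps)
  then have Ec: "E c < 0" using c by (simp add: mult_less_0_iff)
  have cont: "continuous_on {0..c} E"
    unfolding E_def using p by (intro continuous_intros continuous_on_powr') auto
  obtain x where x: "0 \<le> x" "x \<le> c" "E x = 0"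
    using IVT2'[of E c 0 0] E0 Ec c cont by auto
  have "concave_on {0..c} (\<lambda>x. p * (1 - c) * x powr (p - 1))"
    using powr_concave[of "p - 1"] p c
    by (intro concave_on_cmul) (auto simp: concave_on_def intro: convex_on_subset)
  then have conv: "convex_on {0..c} E"
    unfolding E_def diff_conv_add_uminus concave_on_def using p
    by (intro convex_on_add convex_on_cmul) (auto simp: convex_on_const convex_on_ident)
  have "x \<in> {0<..<c}" using x E0 Ec by (auto simp: less_le)
  moreover have "y = x" if "y \<in> {0<..<c}" "E y = 0" for y
    using convex_root_unique[OF conv that(1) \<open>x \<in> _\<close>] that x E0 Ec by (simp add: mult_pos_neg)
  ultimately show ?thesis
    using x unfolding E_def by blast
qed

text \<open>Again the failure of the two other criteria gives the signs at the ends: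
  \<open>E\<close> is negative at c and equals p - 1 - p * c > 0 at 1.\<close>

lemma beta_root_ex1:
  fixes p c :: real
  assumes p: "2 \<le> p" and c: "0 < c" "c < 1 - 1 / p" "p * (1 - c) powr (p - 1) < 1"
  shows "\<exists>!x. x \<in> {c<..<1} \<and> p * c * (1 - x) powr (p - 1) + (p - 1) * x - p * c = 0"
proof -
  define E where "E = (\<lambda>x. p * c * (1 - x) powr (p - 1) + (p - 1) * x - p * c)"
  have c1: "c < 1" "p * c < p - 1"
  proof -
    have "0 < 1 / p" using p by simp
    then show "c < 1" using c by linarith
    show "p * c < p - 1" using mult_strict_left_mono[OF c(2), of p] p by (simp add: algebra_simps)
  qed
  have E1: "E 1 > 0" using c1 p by (simp add: E_def)
  have "E c = c * (p * (1 - c) powr (p - 1) - 1)" by (simp add: E_def algebra_simps)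
  then have Ec: "E c < 0" using c by (simp add: mult_less_0_iff)
  have cont: "continuous_on {c..1} E"
    unfolding E_def using p by (intro continuous_intros continuous_on_powr') auto
  obtain x where x: "c \<le> x" "x \<le> 1" "E x = 0"
    using IVT'[of E c 0 1] E1 Ec c1 cont by auto
  have "convex_on {0..1} (\<lambda>x. x powr (p - 1))"
    using powr_convex_atLeast[of "p - 1"] p by (auto intro: convex_on_subset)
  then have "concave_on {0..1} (\<lambda>x. - (x powr (p - 1)))" by (simp add: concave_on_def)
  from concave_on_reflect[OF this] have "convex_on {0..1} (\<lambda>x. (1 - x) powr (p - 1))"
    by (simp add: concave_on_def)
  then have "convex_on {c..1} (\<lambda>x. (1 - x) powr (p - 1))"
    using c by (auto intro: convex_on_subset)
  then have conv: "convex_on {c..1} E"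
    unfolding E_def diff_conv_add_uminus using p c
    by (intro convex_on_add convex_on_cmul) (auto simp: convex_on_const convex_on_ident)
  have "x \<in> {c<..<1}" using x E1 Ec by (auto simp: less_le)
  moreover have "y = x" if "y \<in> {c<..<1}" "E y = 0" for y
    using convex_root_unique[OF conv that(1) \<open>x \<in> _\<close>] that x E1 Ec by (simp add: mult_neg_pos)
  ultimately show ?thesis
    using x unfolding E_def by blast
qed

lemma powr_le_mono_iff:
  fixes q x y :: real
  assumes "0 < q" "0 \<le> x" "0 \<le> y"
  shows "x powr q \<le> y powr q \<longleftrightarrow> x \<le> y"
  using assms by (meson less_imp_le not_le powr_less_mono2 powr_mono2)

text \<open>Taking powers with exponent p - 1 translates the thresholds on a into the criteria for
  the tangent at c. It is applied to y = c, where p * y = p - 1 - a, and to y = 1 - c, where p * y =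
  1 + a.\<close>

lemma threshold_powr:
  fixes p y :: real
  assumes "1 < p" "0 \<le> y"
  shows "p * y \<le> p powr ((p - 2) / (p - 1)) \<longleftrightarrow> p * y powr (p - 1) \<le> 1"
    and "p powr ((p - 2) / (p - 1)) \<le> p * y \<longleftrightarrow> 1 \<le> p * y powr (p - 1)"
proof -
  define T where "T = p powr ((p - 2) / (p - 1))"
  have T: "0 \<le> T" "T powr (p - 1) = p powr (p - 2)"
    using assms by (auto simp: T_def powr_powr)
  have y: "(p * y) powr (p - 1) = p powr (p - 2) * (p * y powr (p - 1))"
    using assms powr_split[of p "p - 1"] by (simp add: powr_mult)
  have pos: "0 < p powr (p - 2)" using assms by simp
  have "p * y \<le> T \<longleftrightarrow> (p * y) powr (p - 1) \<le> T powr (p - 1)"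
    using assms T(1) by (subst powr_le_mono_iff) auto
  then show "p * y \<le> p powr ((p - 2) / (p - 1)) \<longleftrightarrow> p * y powr (p - 1) \<le> 1"
    unfolding T y using pos by (simp flip: T_def)
  have "T \<le> p * y \<longleftrightarrow> T powr (p - 1) \<le> (p * y) powr (p - 1)"
    using assms T(1) by (subst powr_le_mono_iff) auto
  then show "p powr ((p - 2) / (p - 1)) \<le> p * y \<longleftrightarrow> 1 \<le> p * y powr (p - 1)"
    unfolding T y using pos by (simp flip: T_def)
qed

section \<open>The upper bound\<close>

lemma integral_has_real_derivative_at:
  fixes f :: "real \<Rightarrow> real"
  assumes "continuous_on {0..} f" "0 < t"
  shows "((\<lambda>x. integral {0..x} f) has_real_derivative f t) (at t)"
proof -
  have "((\<lambda>x. integral {0..x} f) has_real_derivative f t) (at t within {0..t+1})"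
    using assms by (intro integral_has_real_derivative) (auto intro: continuous_on_subset)
  moreover have "at t within {0..t+1} = at t"
    using assms by (intro at_within_interior) auto
  ultimately show ?thesis by simp
qed

text \<open>The line inequality at x = f / Hf is multiplied by (Hf)^p t^a and integrated. The linear
  term is then a multiple of the derivative of F^p t^(a+1-p), so it contributes boundary terms
  only.\<close>

lemma hardy_truncated_bound:
  fixes f :: "real \<Rightarrow> real" and p a M \<mu> c e r :: real
  defines "F \<equiv> \<lambda>t. integral {0..t} f"
  assumes p: "1 \<le> p" and c: "c = (p - 1 - a) / p"
    and line: "\<And>x. 0 \<le> x \<Longrightarrow> x \<le> 1 \<Longrightarrow> (1 - x) powr p \<le> M * x powr p + \<mu> * (c - x)"
    and M: "0 \<le> M" "0 \<le> \<mu>"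
    and cont: "continuous_on {0..} f" and f0: "\<And>t. 0 < t \<Longrightarrow> 0 \<le> f t"
    and Fpos: "\<And>t. 0 < t \<Longrightarrow> 0 < F t" and Ff: "\<And>t. 0 < t \<Longrightarrow> t * f t \<le> F t"
    and e: "0 < e" "e \<le> r"
  shows "(\<integral>\<^sup>+t. ennreal (\<bar>F t / t - f t\<bar> powr p * t powr a) * indicator {e..r} t \<partial>lborel)
    \<le> ennreal M * weighted_int p a f + ennreal (\<mu> / p * (F e powr p * e powr (a + 1 - p)))"
proof -
  define \<phi> where "\<phi> = (\<lambda>t. F t powr p * t powr (a + 1 - p))"
  define \<phi>' where "\<phi>' = (\<lambda>t. p * F t powr (p - 1) * f t * t powr (a + 1 - p) + F t powr p * ((a + 1 - p) * t powr (a - p)))"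
  define G where "G = (\<lambda>t. \<bar>F t / t - f t\<bar> powr p * t powr a)"
  define N where "N = (\<lambda>t. f t powr p * t powr a)"
  have dF: "(F has_real_derivative f t) (at t)" if "0 < t" for t
    unfolding F_def using cont that by (rule integral_has_real_derivative_at)
  have cf: "continuous_on {e..r} f"
    using e by (intro continuous_on_subset[OF cont]) auto
  have cF: "continuous_on {e..r} F"
    using e by (intro has_real_derivative_imp_continuous_on[OF dF]) auto
  have "(\<phi> has_real_derivative \<phi>' t) (at t)" if "0 < t" for t
    unfolding \<phi>_def \<phi>'_def using that Fpos[OF that]
    by (auto intro!: derivative_eq_intros dF simp: algebra_simps)
  then have int\<phi>: "(\<phi>' has_integral \<phi> r - \<phi> e) {e..r}"
    using e by (intro fundamental_theorem_of_calculus)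
      (auto intro: has_field_derivative_at_within simp flip: has_real_derivative_iff_has_vector_derivative)
  have "continuous_on {e..r} G" "continuous_on {e..r} N"
    unfolding G_def N_def using e p f0
    by (auto intro!: continuous_intros continuous_on_powr' cf cF)
  then have intG: "(G has_integral integral {e..r} G) {e..r}" and intN: "(N has_integral integral {e..r} N) {e..r}"
    by (auto intro!: integrable_integral integrable_continuous_interval)
  have le: "G t \<le> M * N t - \<mu> / p * \<phi>' t" if t: "t \<in> {e..r}" for t
  proof -
    have t0: "0 < t" and Ft: "0 < F t" using t e Fpos by auto
    \<comment> \<open>\<open>W\<close> is (Hf)^p t^a, the common factor that is left once f and Hf -
      f are expressed through the ratio x = f / Hf.\<close>
    define W where "W = F t powr p * t powr (a - p)"
    define x where "x = t * f t / F t"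
    have x: "0 \<le> x" "x \<le> 1" using t0 Ft f0[OF t0] Ff[OF t0] by (auto simp: x_def)
    have ft: "f t = x * F t / t" using t0 Ft by (simp add: x_def)
    have "F t / t - f t = (1 - x) * (F t / t)" using t0 by (simp add: ft field_simps)
    then have G: "G t = W * (1 - x) powr p"
      using x t0 Ft by (simp add: G_def W_def abs_mult powr_mult powr_divide powr_diff)
    have N: "N t = W * x powr p"
      using x t0 Ft by (simp add: N_def W_def ft powr_mult powr_divide powr_diff)
    have t1: "t powr (a + 1 - p) = t * t powr (a - p)" 
      using t0 by (simp add: powr_diff powr_add)
    have F1: "F t powr (p - 1) * F t = F t powr p"
      using Ft by (simp add: powr_diff)
    have "\<phi>' t = p * x * (F t powr (p - 1) * F t) * t powr (a - p) + (a + 1 - p) * W"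
      using t0 by (simp add: \<phi>'_def t1 ft W_def)
    also have "\<dots> = p * W * (x - c)"
      using p unfolding F1 by (simp add: W_def c field_simps)
    finally have \<phi>'_eq: "\<phi>' t = p * W * (x - c)" .
    have ph: "\<mu> / p * \<phi>' t = - (W * (\<mu> * (c - x)))"
      unfolding \<phi>'_eq using p by (simp add: algebra_simps)
    have "0 \<le> W" by (simp add: W_def)
    then have "W * (1 - x) powr p \<le> W * (M * x powr p + \<mu> * (c - x))"
      using line[OF x] by (intro mult_left_mono) auto
    then show ?thesis unfolding G N ph by (simp add: algebra_simps)
  qed
  have "integral {e..r} G \<le> M * integral {e..r} N - \<mu> / p * (\<phi> r - \<phi> e)"
    by (rule has_integral_le[OF intG has_integral_diff[OF has_integral_mult_right[OF intN] has_integral_mult_right[OF int\<phi>]]])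
      (use le in auto)
  \<comment> \<open>The boundary term at r enters with a minus sign and is dropped, using \<mu>
    \<ge> 0.\<close>
  also have "\<dots> \<le> M * integral {e..r} N + \<mu> / p * \<phi> e"
    using M p by (simp add: \<phi>_def field_simps)
  finally have main: "integral {e..r} G \<le> M * integral {e..r} N + \<mu> / p * \<phi> e" .
  have N0: "0 \<le> integral {e..r} N"
    by (rule has_integral_nonneg[OF intN]) (simp add: N_def)
  have NN: "(\<integral>\<^sup>+t. ennreal (N t) * indicator {e..r} t \<partial>lborel) = ennreal (integral {e..r} N)"
    by (rule nn_integral_has_integral_lebesgue'[OF _ intN]) (simp add: N_def)
  have "(\<integral>\<^sup>+t. ennreal (N t) * indicator {e..r} t \<partial>lborel) \<le> weighted_int p a f"
    unfolding weighted_int_def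
    by (rule nn_integral_mono) (use e f0 in \<open>auto simp: N_def indicator_def\<close>)
  then have Nw: "ennreal (integral {e..r} N) \<le> weighted_int p a f"
    unfolding NN .
  have "(\<integral>\<^sup>+t. ennreal (G t) * indicator {e..r} t \<partial>lborel) = ennreal (integral {e..r} G)"
    by (rule nn_integral_has_integral_lebesgue'[OF _ intG]) (simp add: G_def)
  also have "\<dots> \<le> ennreal (M * integral {e..r} N + \<mu> / p * \<phi> e)"
    using main by (rule ennreal_leI)
  also have "\<dots> = ennreal M * ennreal (integral {e..r} N) + ennreal (\<mu> / p * \<phi> e)"
    using M p N0 by (subst ennreal_plus) (auto simp: ennreal_mult \<phi>_def)
  also have "\<dots> \<le> ennreal M * weighted_int p a f + ennreal (\<mu> / p * \<phi> e)"
    using Nw by (intro add_right_mono mult_left_mono) auto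
  finally show ?thesis by (simp add: G_def \<phi>_def)
qed

text \<open>The intervals [e, r] exhaust the half-line. Continuity at 0 keeps f bounded there, so
  that the boundary term at e tends to 0.\<close>

lemma hardy_continuous_bound:
  fixes f :: "real \<Rightarrow> real" and p a M \<mu> c :: real
  defines "F \<equiv> \<lambda>t. integral {0..t} f"
  assumes p: "1 \<le> p" and a: "-1 < a" and c: "c = (p - 1 - a) / p"
    and line: "\<And>x. 0 \<le> x \<Longrightarrow> x \<le> 1 \<Longrightarrow> (1 - x) powr p \<le> M * x powr p + \<mu> * (c - x)"
    and M: "0 \<le> M" "0 \<le> \<mu>"
    and cont: "continuous_on {0..} f" and f0: "\<And>t. 0 < t \<Longrightarrow> 0 \<le> f t"
    and anti: "antimono_on {0<..} f"
  shows "(\<integral>\<^sup>+t\<in>{0<..}. ennreal (\<bar>F t / t - f t\<bar> powr p * t powr a) \<partial>lborel) \<le> ennreal M * weighted_int p a f"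
proof -
  have f_int: "f integrable_on {u..v}" if "0 \<le> u" for u v
    using that cont by (intro integrable_continuous_interval) (auto intro: continuous_on_subset)
  have f_anti: "f y \<le> f x" if "0 < x" "x \<le> y" for x y
    using anti that by (auto simp: monotone_on_def)
  have Ff: "t * f s \<le> F t" if "0 < t" "t \<le> s" for s t
  proof -
    \<comment> \<open>Monotonicity is assumed on the open half-line only, so the value at 0 is
      replaced by \<open>f s\<close> before comparing.\<close>
    have "integral {0..t} (\<lambda>_. f s) \<le> integral {0..t} (\<lambda>x. if x = 0 then f s else f x)"
      using that f_anti by (intro integral_le integrable_const_ivl integrable_spike_finite[of "{0}", OF _ _ f_int[of 0 t]]) auto
    also have "\<dots> = F t" unfolding F_def
      by (rule integral_spike[of "{0}"]) auto
    finally show ?thesis using that by simp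
  qed
  show ?thesis
  proof (cases "\<exists>t>0. f t \<noteq> 0")
    case False
    have F0: "F t = 0" for t
    proof -
      have "F t = integral {0..t} (\<lambda>_. 0)"
        unfolding F_def using False by (intro integral_spike[of "{0}"]) auto
      then show ?thesis by simp
    qed
    have "(\<integral>\<^sup>+t\<in>{0<..}. ennreal (\<bar>F t / t - f t\<bar> powr p * t powr a) \<partial>lborel) = (\<integral>\<^sup>+(t::real). 0 \<partial>lborel)"
      using False by (intro nn_integral_cong) (auto simp: F0 indicator_def)
    then show ?thesis by simp
  next
    case True
    then obtain s where s: "0 < s" "0 < f s" using f0 by force
    \<comment> \<open>The ratio f / Hf requires F > 0. A decreasing f that is positive at s is at
      least \<open>f s\<close> on (0, s], so F is positive everywhere.\<close>
    have Fpos: "0 < F t" if t: "0 < t" for t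
    proof (cases "t \<le> s")
      case True
      then show ?thesis using Ff[OF t True] s t by (smt (verit) mult_pos_pos)
    next
      case False
      have "0 < F s" using Ff[of s s] s by (smt (verit) mult_pos_pos)
      moreover have "F t = F s + integral {s..t} f"
        unfolding F_def using False s f_int[of 0 t] by (intro Henstock_Kurzweil_Integration.integral_combine[symmetric]) auto
      moreover have "0 \<le> integral {s..t} f"
        using s f_int f0 by (intro integral_nonneg) auto
      ultimately show ?thesis by linarith
    qed
    define G where "G = (\<lambda>t. ennreal (\<bar>F t / t - f t\<bar> powr p * t powr a))"
    define e where "e = (\<lambda>m. 1 / real (Suc m))"
    define \<phi> where "\<phi> = (\<lambda>t. F t powr p * t powr (a + 1 - p))"
    have e: "0 < e m" "e m \<le> 1" for m
      by (auto simp: e_def divide_simps)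
    have er: "e m \<le> real (Suc m)" for m
      using e(2)[of m] by linarith
    have part: "(\<integral>\<^sup>+t. G t * indicator {e m..real (Suc m)} t \<partial>lborel)
        \<le> ennreal M * weighted_int p a f + ennreal (\<mu> / p * \<phi> (e m))" for m
      unfolding G_def \<phi>_def F_def
      by (rule hardy_truncated_bound[OF p c line M cont f0]) (use Fpos Ff e er in \<open>auto simp: F_def\<close>)
    obtain B where B: "\<And>x. x \<in> {0..1} \<Longrightarrow> \<bar>f x\<bar> \<le> B"
    proof -
      have "compact (f ` {0..1})"
        using cont by (intro compact_continuous_image) (auto intro: continuous_on_subset)
      then obtain B where "\<forall>x\<in>{0..1}. \<bar>f x\<bar> \<le> B"
        by (auto dest!: compact_imp_bounded simp: bounded_iff)
      then show ?thesis using that by blast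
    qed
    have B0: "0 \<le> B" using B[of 0] by simp
    \<comment> \<open>Near 0 one has F t \<le> B t, so the boundary term is at most a constant times
      t^(a+1), which vanishes at 0 because -1 < a.\<close>
    have phi: "\<phi> t \<le> B powr p * t powr (a + 1)" if "0 < t" "t \<le> 1" for t
    proof -
      have "F t \<le> integral {0..t} (\<lambda>_. B)"
        unfolding F_def using f_int that B by (intro integral_le) (auto simp: abs_le_iff)
      then have "F t \<le> B * t" using that by (simp add: mult.commute)
      then have "F t powr p \<le> (B * t) powr p"
        using Fpos[OF that(1)] p by (intro powr_mono2) auto
      then have "\<phi> t \<le> (B * t) powr p * t powr (a + 1 - p)"
        unfolding \<phi>_def by (rule mult_right_mono) simp
      also have "\<dots> = B powr p * t powr (a + 1)"
        using that B0 by (simp add: powr_mult powr_diff)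
      finally show ?thesis .
    qed
    have "(\<lambda>m. e m) \<longlonglongrightarrow> 0"
      unfolding e_def by (rule LIMSEQ_Suc[OF lim_1_over_n])
    then have "(\<lambda>m. \<mu> / p * (B powr p * e m powr (a + 1))) \<longlonglongrightarrow> \<mu> / p * (B powr p * 0 powr (a + 1))"
      using a e by (intro tendsto_intros tendsto_powr2 always_eventually) (auto intro: less_imp_le)
    then have "(\<lambda>m. ennreal (\<mu> / p * (B powr p * e m powr (a + 1)))) \<longlonglongrightarrow> ennreal 0"
      by (intro tendsto_ennrealI) simp
    then have lim: "(\<lambda>m. ennreal M * weighted_int p a f + ennreal (\<mu> / p * (B powr p * e m powr (a + 1))))
        \<longlonglongrightarrow> ennreal M * weighted_int p a f + 0"
      by (intro tendsto_add tendsto_const) simp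
    have part': "(\<integral>\<^sup>+t. G t * indicator {e m..real (Suc m)} t \<partial>lborel)
        \<le> ennreal M * weighted_int p a f + ennreal (\<mu> / p * (B powr p * e m powr (a + 1)))" for m
      using phi[OF e(1,2)] M p
      by (intro order_trans[OF part] add_left_mono ennreal_leI mult_left_mono) auto
    have contG: "continuous_on {0<..} (\<lambda>t. \<bar>F t / t - f t\<bar> powr p * t powr a)"
    proof -
      have "continuous_on {0<..} F"
        unfolding F_def using integral_has_real_derivative_at[OF cont]
        by (intro has_real_derivative_imp_continuous_on) auto
      moreover have "continuous_on {0<..} f"
        using cont by (rule continuous_on_subset) auto
      ultimately show ?thesis
        using p by (intro continuous_intros continuous_on_powr') auto
    qed
    have meas: "(\<lambda>t. G t * indicator {0<..} t) \<in> borel_measurable lborel"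
    proof -
      have "(\<lambda>t. indicator {0<..} t *\<^sub>R (\<bar>F t / t - f t\<bar> powr p * t powr a)) \<in> borel_measurable borel"
        by (rule borel_measurable_continuous_on_indicator[OF _ contG]) auto
      then have "(\<lambda>t. ennreal (indicator {0<..} t *\<^sub>R (\<bar>F t / t - f t\<bar> powr p * t powr a))) \<in> borel_measurable borel"
        by measurable
      also have "(\<lambda>t. ennreal (indicator {0<..} t *\<^sub>R (\<bar>F t / t - f t\<bar> powr p * t powr a))) = (\<lambda>t. G t * indicator {0<..} t)"
        by (auto simp: G_def indicator_def)
      finally show ?thesis by simp
    qed
    have mem: "\<exists>m. \<forall>n\<ge>m. t \<in> {e n..real (Suc n)}" if "0 < t" for t
    proof -
      obtain m where m: "max t (1 / t) < real m" using reals_Archimedean2 by blast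
      have "t \<in> {e n..real (Suc n)}" if "n \<ge> m" for n
      proof -
        have "t < real (Suc n)" "1 / t < real (Suc n)" using m that by auto
        then show ?thesis using \<open>0 < t\<close> by (simp add: e_def field_simps)
      qed
      then show ?thesis by blast
    qed
    define H where "H = (\<lambda>m t. G t * indicator {e m..real (Suc m)} t)"
    have Hlim: "(\<lambda>m. H m t) \<longlonglongrightarrow> G t * indicator {0<..} t" for t
    proof (cases "0 < t")
      case True
      then obtain m where "\<forall>n\<ge>m. t \<in> {e n..real (Suc n)}" using mem by blast
      then have "eventually (\<lambda>n. H n t = G t * indicator {0<..} t) sequentially"
        using True by (auto simp: eventually_sequentially H_def indicator_def)
      then show ?thesis by (rule tendsto_eventually)
    next
      case False
      have "t \<notin> {e m..real (Suc m)}" for m using e(1)[of m] False by auto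
      then show ?thesis using False by (simp add: H_def)
    qed
    have Hm: "H m \<in> borel_measurable lborel" for m
    proof -
      have "H m = (\<lambda>t. (G t * indicator {0<..} t) * indicator {e m..real (Suc m)} t)"
        using e(1)[of m] by (auto simp: H_def indicator_def fun_eq_iff)
      then show ?thesis using meas by simp
    qed
    have "(\<integral>\<^sup>+t. G t * indicator {0<..} t \<partial>lborel) = (\<integral>\<^sup>+t. liminf (\<lambda>m. H m t) \<partial>lborel)"
      using Hlim by (intro nn_integral_cong lim_imp_Liminf[symmetric]) auto
    also have "\<dots> \<le> liminf (\<lambda>m. \<integral>\<^sup>+t. H m t \<partial>lborel)"
      using Hm by (rule nn_integral_liminf)
    also have "\<dots> \<le> liminf (\<lambda>m. ennreal M * weighted_int p a f + ennreal (\<mu> / p * (B powr p * e m powr (a + 1))))"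
      using part' by (intro Liminf_mono always_eventually) (simp add: H_def)
    also have "\<dots> = ennreal M * weighted_int p a f"
      using lim_imp_Liminf[OF _ lim] by simp
    finally show ?thesis by (simp add: G_def)
  qed
qed

section \<open>From continuous to arbitrary decreasing functions\<close>

text \<open>Membership in the class restricts f on (0, \<infinity>) only. Setting it to 0 elsewhere
  gives a Borel function, and local integrability follows from the power bound obtained by comparing
  f with its value at x on (0, x].\<close>

lemma hardy_class_properties:
  fixes f :: "real \<Rightarrow> real" and p a :: real
  defines "g \<equiv> \<lambda>t. if 0 < t then f t else 0"
  assumes p: "1 \<le> p" and a: "-1 < a" "a < p - 1" and f: "f \<in> hardy_class p a"
  shows "g \<in> borel_measurable borel"
    and "g integrable_on {0..t}"
    and "hardy_op f t = integral {0..t} g / t"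
proof -
  have f0: "0 \<le> f t" if "0 < t" for t using f that by (auto simp: hardy_class_def)
  have anti: "f y \<le> f x" if "0 < x" "x \<le> y" for x y
    using f that by (auto simp: hardy_class_def monotone_on_def)
  have "mono_on {0<..} (\<lambda>x. - f x)"
    using anti by (auto simp: mono_on_def)
  then have "(\<lambda>x. - f x) \<in> borel_measurable (restrict_space borel {0<..})"
    by (rule borel_measurable_mono_on_fnc)
  then have "(\<lambda>x. if x \<in> {0<..} then - f x else 0) \<in> borel_measurable borel"
    by (subst (asm) measurable_restrict_space_iff) auto
  then have "(\<lambda>x. - (if x \<in> {0<..} then - f x else 0)) \<in> borel_measurable borel"
    by measurable
  also have "(\<lambda>x. - (if x \<in> {0<..} then - f x else 0)) = g"
    by (auto simp: g_def)
  finally show g: "g \<in> borel_measurable borel" .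
  have "weighted_int p a f < \<infinity>" using f by (simp add: hardy_class_def)
  then obtain w where w: "0 \<le> w" "weighted_int p a f = ennreal w"
    by (cases "weighted_int p a f") auto
  have pw: "f x \<le> (w * (a + 1)) powr (1 / p) * x powr (- (a + 1) / p)" if x: "0 < x" for x
  proof -
    have i: "((\<lambda>t. f x powr p * t powr a) has_integral f x powr p * (x powr (a + 1) / (a + 1))) {0..x}"
      using has_integral_powr_from_0[of a x] a x by (intro has_integral_mult_right) auto
    have "ennreal (f x powr p * (x powr (a + 1) / (a + 1))) = (\<integral>\<^sup>+t. ennreal (f x powr p * t powr a) * indicator {0..x} t \<partial>lborel)"
      by (rule nn_integral_has_integral_lebesgue'[symmetric, OF _ i]) simp
    also have "\<dots> \<le> weighted_int p a f"
      unfolding weighted_int_def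
    proof (rule nn_integral_mono_AE)
      show "AE t in lborel. ennreal (f x powr p * t powr a) * indicator {0..x} t \<le> ennreal (\<bar>f t\<bar> powr p * t powr a) * indicator {0<..} t"
      proof (rule eventually_mono[OF AE_lborel_singleton[of 0]])
        fix t :: real assume "t \<noteq> 0"
        then show "ennreal (f x powr p * t powr a) * indicator {0..x} t \<le> ennreal (\<bar>f t\<bar> powr p * t powr a) * indicator {0<..} t"
          using anti[of t x] f0[OF x] f0[of t] p
          by (auto simp: indicator_def intro!: ennreal_leI mult_right_mono powr_mono2)
      qed
    qed
    finally have "f x powr p * (x powr (a + 1) / (a + 1)) \<le> w"
      using w by (simp add: ennreal_le_iff)
    then have "f x powr p \<le> (w * (a + 1)) * x powr (- (a + 1))"
      using a x unfolding powr_minus by (simp add: field_simps)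
    then have "(f x powr p) powr (1 / p) \<le> ((w * (a + 1)) * x powr (- (a + 1))) powr (1 / p)"
      using p by (intro powr_mono2) auto
    also have "(f x powr p) powr (1 / p) = f x" using p f0[OF x] by (simp add: powr_powr)
    also have "((w * (a + 1)) * x powr (- (a + 1))) powr (1 / p) = (w * (a + 1)) powr (1 / p) * x powr (- (a + 1) / p)"
      using w a x by (simp add: powr_mult powr_powr)
    finally show ?thesis .
  qed
  define C where "C = (w * (a + 1)) powr (1 / p)"
  define q where "q = - (a + 1) / p"
  \<comment> \<open>The condition a < p - 1 makes the dominating power integrable at 0.\<close>
  have q: "q > -1" using a p by (simp add: q_def field_simps)
  have int: "set_integrable lborel {0..t} g" for t
    unfolding set_integrable_def
  proof (rule integrableI_bounded)
    show "(\<lambda>x. indicator {0..t} x *\<^sub>R g x) \<in> borel_measurable lborel"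
      using g by measurable
    show "(\<integral>\<^sup>+x. ennreal (norm (indicator {0..t} x *\<^sub>R g x)) \<partial>lborel) < \<infinity>"
    proof (cases "0 \<le> t")
      case True
      have i: "((\<lambda>x. C * x powr q) has_integral C * (t powr (q + 1) / (q + 1))) {0..t}"
        using has_integral_powr_from_0[OF q True] by (rule has_integral_mult_right)
      have "(\<integral>\<^sup>+x. ennreal (norm (indicator {0..t} x *\<^sub>R g x)) \<partial>lborel) \<le> (\<integral>\<^sup>+x. ennreal (C * x powr q) * indicator {0..t} x \<partial>lborel)"
        using pw f0 by (intro nn_integral_mono) (auto simp: indicator_def g_def C_def q_def intro!: ennreal_leI)
      also have "\<dots> = ennreal (C * (t powr (q + 1) / (q + 1)))"
        by (rule nn_integral_has_integral_lebesgue'[OF _ i]) (simp add: C_def)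
      also have "\<dots> < \<infinity>" by simp
      finally show ?thesis .
    qed simp
  qed
  show "g integrable_on {0..t}"
    using set_borel_integral_eq_integral(1)[OF int] .
  \<comment> \<open>On [0, t] the functions f and g differ at most at 0; the difference is an
    integrable multiple of the indicator of {0}.\<close>
  have "(LINT s:{0..t}|lborel. f s) = (LINT s:{0..t}|lborel. g s)"
  proof -
    have "(\<lambda>s. indicator {0..t} s *\<^sub>R f s) = (\<lambda>s. indicator {0..t} s *\<^sub>R g s + indicator {0} s *\<^sub>R (indicator {0..t} 0 *\<^sub>R f 0))"
      by (auto simp: g_def indicator_def)
    moreover have "integrable lborel (\<lambda>s. indicator {0} s *\<^sub>R (indicator {0..t} 0 *\<^sub>R f 0))"
      by (intro integrable_indicator) auto
    ultimately show ?thesis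
      using int[of t] unfolding set_lebesgue_integral_def set_integrable_def by simp
  qed
  then show "hardy_op f t = integral {0..t} g / t"
    unfolding hardy_op_def using set_borel_integral_eq_integral(2)[OF int] by simp
qed

text \<open>The fundamental theorem of calculus needs a continuous integrand, hence \<open>f\<close> is replaced by the
  averages \<open>(F (t + \<delta>) - F t) / \<delta>\<close>.  They are again decreasing, stay below \<open>f\<close>, are bounded near 0,
  and converge to \<open>f\<close> off the countable set of its discontinuities; Fatou's lemma does the rest.\<close>

lemma hardy_class_bound:
  fixes f :: "real \<Rightarrow> real" and p a M \<mu> c :: real
  assumes p: "1 \<le> p" and a: "-1 < a" "a < p - 1" and c: "c = (p - 1 - a) / p"
    and line: "\<And>x. 0 \<le> x \<Longrightarrow> x \<le> 1 \<Longrightarrow> (1 - x) powr p \<le> M * x powr p + \<mu> * (c - x)"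
    and M: "0 \<le> M" "0 \<le> \<mu>"
    and f: "f \<in> hardy_class p a"
  shows "weighted_int p a (\<lambda>t. hardy_op f t - f t) \<le> ennreal M * weighted_int p a f"
proof -
  define g where "g = (\<lambda>t. if 0 < t then f t else 0)"
  define F where "F = (\<lambda>t. integral {0..t} g)"
  note props = hardy_class_properties[OF p a f, folded g_def]
  have g0: "0 \<le> g t" for t using f by (auto simp: hardy_class_def g_def)
  have g_anti: "g y \<le> g x" if "0 < x" "x \<le> y" for x y
    using f that by (auto simp: hardy_class_def monotone_on_def g_def)
  have g_int: "g integrable_on {u..v}" if "0 \<le> u" for u v
    using props(2)[of v] by (rule integrable_on_subinterval) (use that in auto)
  have F_diff: "F v - F u = integral {u..v} g" if "0 \<le> u" "u \<le> v" for u v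
    using Henstock_Kurzweil_Integration.integral_combine[OF that props(2)] unfolding F_def by linarith
  have F_upper: "F v - F u \<le> (v - u) * g u" if "0 < u" "u \<le> v" for u v
  proof -
    have "integral {u..v} g \<le> integral {u..v} (\<lambda>_. g u)"
      using that g_int[of u v] g_anti by (intro integral_le) auto
    then show ?thesis using F_diff[of u v] that by simp
  qed
  have F_lower: "(v - u) * g v \<le> F v - F u" if "0 < u" "u \<le> v" for u v
  proof -
    have "integral {u..v} (\<lambda>_. g v) \<le> integral {u..v} g"
      using that g_int[of u v] g_anti by (intro integral_le) auto
    then show ?thesis using F_diff[of u v] that by simp
  qed
  have F_mono: "F u \<le> F v" if "0 \<le> u" "u \<le> v" for u v
  proof -
    have "0 \<le> integral {u..v} g"
      using that g0 g_int by (intro integral_nonneg) auto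
    then show ?thesis using F_diff[OF that] by simp
  qed
  have F_cont: "continuous_on {0..} F"
  proof -
    have "continuous (at x within {0..}) F" if "0 \<le> x" for x
    proof -
      have "continuous_on {0..x+1} F"
        unfolding F_def by (rule indefinite_integral_continuous_1[OF props(2)])
      then have "continuous (at x within {0..x+1}) F"
        using that by (simp add: continuous_on_eq_continuous_within)
      moreover have "at x within {0..x+1} = at x within {0..}"
        by (rule at_within_nhd[of x "{x-1<..<x+1}"]) auto
      ultimately show ?thesis by simp
    qed
    then show ?thesis by (auto simp: continuous_on_eq_continuous_within)
  qed
  define \<delta> where "\<delta> = (\<lambda>n. 1 / real (Suc n))"
  have \<delta>: "0 < \<delta> n" for n by (simp add: \<delta>_def)
  have \<delta>_lim: "\<delta> \<longlonglongrightarrow> 0"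
    unfolding \<delta>_def by (rule LIMSEQ_Suc[OF lim_1_over_n])
  define fn where "fn = (\<lambda>n t. (F (t + \<delta> n) - F t) / \<delta> n)"
  define Fn where "Fn = (\<lambda>n t. integral {0..t} (fn n))"
  have fn_cont: "continuous_on {0..} (fn n)" for n
    unfolding fn_def using \<delta>[of n]
    by (intro continuous_intros continuous_on_compose2[OF F_cont]) (auto intro: less_imp_le)
  have fn0: "0 \<le> fn n t" if "0 \<le> t" for n t
    using F_mono[of t "t + \<delta> n"] \<delta>[of n] that by (simp add: fn_def)
  have fn_le: "fn n t \<le> g t" if "0 < t" for n t
    using F_upper[of t "t + \<delta> n"] \<delta>[of n] that by (simp add: fn_def field_simps)
  have fn_ge: "g (t + \<delta> n) \<le> fn n t" if "0 < t" for n t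
    using F_lower[of t "t + \<delta> n"] \<delta>[of n] that by (simp add: fn_def field_simps)
  have fn_anti: "antimono_on {0<..} (fn n)" for n
  proof (rule monotone_onI)
    fix s t :: real assume st: "s \<in> {0<..}" "t \<in> {0<..}" "s \<le> t"
    \<comment> \<open>If the windows [s, s + \<delta>] and [t, t + \<delta>] do not overlap,
      \<open>g (s + \<delta> n)\<close> separates the two averages. If they overlap, the common part
      cancels, leaving [s, t] against its shift by \<delta>.\<close>
    show "fn n t \<le> fn n s"
    proof (cases "s + \<delta> n \<le> t")
      case True
      then show ?thesis
        using fn_le[of t n] fn_ge[of s n] g_anti[of "s + \<delta> n" t] \<delta>[of n] st by force
    next
      case False
      have "F (t + \<delta> n) - F (s + \<delta> n) \<le> (t - s) * g (s + \<delta> n)"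
        using F_upper[of "s + \<delta> n" "t + \<delta> n"] \<delta>[of n] st by simp
      also have "\<dots> \<le> (t - s) * g t"
        using False st g_anti[of t "s + \<delta> n"] by (intro mult_left_mono) auto
      also have "\<dots> \<le> F t - F s"
        using F_lower[of s t] st by simp
      finally show ?thesis
        using \<delta>[of n] by (simp add: fn_def divide_right_mono)
    qed
  qed
  define N where "N = {x \<in> {0<..}. \<not> isCont g x}"
  have "countable {x \<in> {0<..}. \<not> isCont (\<lambda>x. - g x) x}"
    using g_anti by (intro mono_on_ctble_discont_open) (auto simp: mono_on_def)
  moreover have "isCont (\<lambda>x. - g x) x \<longleftrightarrow> isCont g x" for x
    using continuous_minus[of "at x" g] continuous_minus[of "at x" "\<lambda>x. - g x"] by auto
  ultimately have N: "countable N" by (simp add: N_def)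
  have fn_lim: "(\<lambda>n. fn n t) \<longlonglongrightarrow> g t" if t: "0 < t" "t \<notin> N" for t
  proof (rule real_tendsto_sandwich)
    have "isCont g t" using t by (simp add: N_def)
    moreover have "(\<lambda>n. t + \<delta> n) \<longlonglongrightarrow> t"
      using tendsto_add[OF tendsto_const \<delta>_lim, of t] by simp
    ultimately show "(\<lambda>n. g (t + \<delta> n)) \<longlonglongrightarrow> g t"
      by (rule isCont_tendsto_compose)
  qed (use t fn_le fn_ge in auto)
  have Fn_lim: "(\<lambda>n. Fn n t) \<longlonglongrightarrow> F t" for t
  proof -
    define Z where "Z = insert 0 N"
    have "Z \<in> null_sets lborel"
      using N by (intro countable_imp_null_set_lborel) (simp add: Z_def)
    then have Z: "negligible Z"
      unfolding negligible_iff_null_sets by (rule null_sets_completionI)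
    have fn_int: "fn n integrable_on {0..t}" for n
      by (intro integrable_continuous_interval continuous_on_subset[OF fn_cont]) auto
    have "(\<lambda>n. integral {0..t} (\<lambda>x. if x \<in> Z then 0 else fn n x)) \<longlonglongrightarrow> integral {0..t} (\<lambda>x. if x \<in> Z then 0 else g x)"
    proof (rule dominated_convergence(2))
      show "(\<lambda>x. if x \<in> Z then 0 else fn n x) integrable_on {0..t}" for n
        by (rule integrable_spike[OF fn_int Z]) simp
      show "(\<lambda>x. if x \<in> Z then 0 else g x) integrable_on {0..t}"
        by (rule integrable_spike[OF props(2) Z]) simp
      show "norm (if x \<in> Z then 0 else fn n x) \<le> (if x \<in> Z then 0 else g x)" if "x \<in> {0..t}" for n x
        using that fn0[of x n] fn_le[of x n] by (auto simp: Z_def)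
      show "(\<lambda>n. if x \<in> Z then 0 else fn n x) \<longlonglongrightarrow> (if x \<in> Z then 0 else g x)" if "x \<in> {0..t}" for x
        using that fn_lim[of x] by (auto simp: Z_def)
    qed
    moreover have "integral {0..t} (\<lambda>x. if x \<in> Z then 0 else fn n x) = Fn n t" for n
      unfolding Fn_def by (rule integral_spike[OF Z]) simp
    moreover have "integral {0..t} (\<lambda>x. if x \<in> Z then 0 else g x) = F t"
      unfolding F_def by (rule integral_spike[OF Z]) simp
    ultimately show ?thesis by simp
  qed
  define h where "h = (\<lambda>n t. ennreal (\<bar>Fn n t / t - fn n t\<bar> powr p * t powr a) * indicator {0<..} t)"
  have h_meas: "h n \<in> borel_measurable lborel" for n
  proof -
    have "continuous_on {0<..} (Fn n)"
      unfolding Fn_def using integral_has_real_derivative_at[OF fn_cont]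
      by (intro has_real_derivative_imp_continuous_on) auto
    moreover have "continuous_on {0<..} (fn n)"
      using fn_cont by (rule continuous_on_subset) auto
    ultimately have "continuous_on {0<..} (\<lambda>t. \<bar>Fn n t / t - fn n t\<bar> powr p * t powr a)"
      using p by (intro continuous_intros continuous_on_powr') auto
    then have "(\<lambda>t. indicator {0<..} t *\<^sub>R (\<bar>Fn n t / t - fn n t\<bar> powr p * t powr a)) \<in> borel_measurable borel"
      by (rule borel_measurable_continuous_on_indicator[rotated]) auto
    then have "(\<lambda>t. ennreal (indicator {0<..} t *\<^sub>R (\<bar>Fn n t / t - fn n t\<bar> powr p * t powr a))) \<in> borel_measurable borel"
      by measurable
    also have "(\<lambda>t. ennreal (indicator {0<..} t *\<^sub>R (\<bar>Fn n t / t - fn n t\<bar> powr p * t powr a))) = h n"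
      by (auto simp: h_def indicator_def)
    finally show ?thesis by simp
  qed
  have h_bound: "(\<integral>\<^sup>+t. h n t \<partial>lborel) \<le> ennreal M * weighted_int p a f" for n
  proof -
    have "(\<integral>\<^sup>+t. h n t \<partial>lborel) \<le> ennreal M * weighted_int p a (fn n)"
      unfolding h_def Fn_def
      by (rule hardy_continuous_bound[OF p a(1) c line M fn_cont _ fn_anti]) (auto intro: fn0)
    \<comment> \<open>Since \<open>fn n\<close> stays below f, the right-hand side is bounded
      uniformly in n, and only the left-hand side has to pass to the limit.\<close>
    also have "weighted_int p a (fn n) \<le> weighted_int p a f"
      unfolding weighted_int_def
    proof (intro nn_integral_mono)
      fix t :: real
      show "ennreal (\<bar>fn n t\<bar> powr p * t powr a) * indicator {0<..} t \<le> ennreal (\<bar>f t\<bar> powr p * t powr a) * indicator {0<..} t"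
        using fn0[of t n] fn_le[of t n] p
        by (auto simp: indicator_def g_def intro!: ennreal_leI mult_right_mono powr_mono2)
    qed
    finally show ?thesis by (simp add: mult_left_mono)
  qed
  have AE_N: "AE t in lborel. t \<notin> N"
    using N by (intro AE_not_in countable_imp_null_set_lborel)
  have "weighted_int p a (\<lambda>t. hardy_op f t - f t) = (\<integral>\<^sup>+t. liminf (\<lambda>n. h n t) \<partial>lborel)"
    unfolding weighted_int_def
  proof (rule nn_integral_cong_AE, rule eventually_mono[OF AE_N])
    fix t :: real assume t: "t \<notin> N"
    show "ennreal (\<bar>hardy_op f t - f t\<bar> powr p * t powr a) * indicator {0<..} t = liminf (\<lambda>n. h n t)"
    proof (cases "0 < t")
      case True
      have "(\<lambda>n. ennreal (\<bar>Fn n t / t - fn n t\<bar> powr p * t powr a)) \<longlonglongrightarrow> ennreal (\<bar>F t / t - g t\<bar> powr p * t powr a)"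
        using p fn_lim[OF True t] True
        by (intro tendsto_ennrealI tendsto_intros tendsto_powr2 Fn_lim always_eventually) auto
      from lim_imp_Liminf[OF _ this] show ?thesis
        using True props(3)[of t] by (simp add: h_def F_def g_def)
    next
      case False
      then show ?thesis by (simp add: h_def Liminf_const)
    qed
  qed
  also have "\<dots> \<le> liminf (\<lambda>n. \<integral>\<^sup>+t. h n t \<partial>lborel)"
    using h_meas by (rule nn_integral_liminf)
  also have "\<dots> \<le> liminf (\<lambda>n. ennreal M * weighted_int p a f)"
    using h_bound by (intro Liminf_mono always_eventually) simp
  finally show ?thesis by (simp add: Liminf_const)
qed

section \<open>The power functions as lower bound\<close>

text \<open>The factors \<beta> and \<alpha> make the primitives t^\<beta> and t^\<alpha> fit
  together at 1, so that Hf is a pure power on each piece and f / Hf is constant there.\<close>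

lemma has_integral_power_pieces:
  fixes \<alpha> \<beta> t :: real
  assumes "0 \<le> \<alpha>" "0 < \<beta>" "0 \<le> t"
  shows "((\<lambda>s. if s \<le> 1 then \<beta> * s powr (\<beta> - 1) else \<alpha> * s powr (\<alpha> - 1))
     has_integral (if t \<le> 1 then t powr \<beta> else t powr \<alpha>)) {0..t}" (is "(?f has_integral _) _")
proof -
  have near: "(?f has_integral u powr \<beta>) {0..u}" if "0 \<le> u" "u \<le> 1" for u
  proof -
    have "((\<lambda>s. \<beta> * s powr (\<beta> - 1)) has_integral \<beta> * (u powr (\<beta> - 1 + 1) / (\<beta> - 1 + 1))) {0..u}"
      using assms that by (intro has_integral_mult_right has_integral_powr_from_0) auto
    moreover have "\<beta> * (u powr (\<beta> - 1 + 1) / (\<beta> - 1 + 1)) = u powr \<beta>" using assms by simp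
    ultimately show ?thesis
      using that by (subst has_integral_cong[where g = "\<lambda>s. \<beta> * s powr (\<beta> - 1)"]) auto
  qed
  show ?thesis
  proof (cases "t \<le> 1")
    case True
    then show ?thesis using near assms by simp
  next
    case False
    have "(?f has_integral t powr \<alpha> - 1 powr \<alpha>) {1..t}"
    proof (rule fundamental_theorem_of_calculus_interior)
      show "continuous_on {1..t} (\<lambda>s. s powr \<alpha>)"
        by (intro continuous_intros) auto
      show "((\<lambda>s. s powr \<alpha>) has_vector_derivative ?f x) (at x)" if "x \<in> {1<..<t}" for x
        using that by (auto intro!: derivative_eq_intros simp flip: has_real_derivative_iff_has_vector_derivative)
    qed (use False in auto)
    from has_integral_combine[OF _ _ near[of 1] this] show ?thesis using False by simp
  qed
qed

lemma nn_integral_power_pieces: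
  fixes A B d e :: real
  assumes "0 \<le> A" "0 \<le> B" "-1 < d" "e < -1"
  shows "(\<integral>\<^sup>+t\<in>{0<..}. ennreal (if t \<le> 1 then B * t powr d else A * t powr e) \<partial>lborel)
    = ennreal (B / (d + 1) + A / (- (e + 1)))"
proof -
  have i1: "((\<lambda>t. B * t powr d) has_integral B * (1 powr (d + 1) / (d + 1))) {0..1}"
    using assms by (intro has_integral_mult_right has_integral_powr_from_0) auto
  have i2: "((\<lambda>t. A * t powr e) has_integral A * (- (1 powr (e + 1)) / (e + 1))) {1..}"
    using assms by (intro has_integral_mult_right has_integral_powr_to_inf) auto
  have "(\<integral>\<^sup>+t\<in>{0<..}. ennreal (if t \<le> 1 then B * t powr d else A * t powr e) \<partial>lborel)
      = (\<integral>\<^sup>+t. ennreal (B * t powr d) * indicator {0..1} t + ennreal (A * t powr e) * indicator {1..} t \<partial>lborel)"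
  proof (rule nn_integral_cong_AE)
    show "AE t in lborel. ennreal (if t \<le> 1 then B * t powr d else A * t powr e) * indicator {0<..} t
      = ennreal (B * t powr d) * indicator {0..1} t + ennreal (A * t powr e) * indicator {1..} t"
      using AE_lborel_singleton[of 0] AE_lborel_singleton[of 1]
      by eventually_elim (auto simp: indicator_def)
  qed
  also have "\<dots> = (\<integral>\<^sup>+t. ennreal (B * t powr d) * indicator {0..1} t \<partial>lborel) + (\<integral>\<^sup>+t. ennreal (A * t powr e) * indicator {1..} t \<partial>lborel)"
    by (intro nn_integral_add) measurable
  also have "(\<integral>\<^sup>+t. ennreal (B * t powr d) * indicator {0..1} t \<partial>lborel) = ennreal (B * (1 powr (d + 1) / (d + 1)))"
    by (rule nn_integral_has_integral_lebesgue'[OF _ i1]) (use assms in auto)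
  also have "(\<integral>\<^sup>+t. ennreal (A * t powr e) * indicator {1..} t \<partial>lborel) = ennreal (A * (- (1 powr (e + 1)) / (e + 1)))"
    by (rule nn_integral_has_integral_lebesgue'[OF _ i2]) (use assms in auto)
  also have "ennreal (B * (1 powr (d + 1) / (d + 1))) + ennreal (A * (- (1 powr (e + 1)) / (e + 1)))
     = ennreal (B * (1 powr (d + 1) / (d + 1)) + A * (- (1 powr (e + 1)) / (e + 1)))"
    using assms by (intro ennreal_plus[symmetric] mult_nonneg_nonneg) (auto simp: divide_nonpos_neg)
  also have "B * (1 powr (d + 1) / (d + 1)) + A * (- (1 powr (e + 1)) / (e + 1)) = B / (d + 1) + A / (- (e + 1))"
    by (simp only: divide_minus_right minus_divide_left) simp
  finally show ?thesis .
qed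

lemma kfun_le_hardy_bound:
  fixes p a \<alpha> \<beta> c K :: real
  assumes p: "1 \<le> p" and a: "-1 < a" "a < p - 1" and c: "c = (p - 1 - a) / p"
    and \<alpha>: "0 \<le> \<alpha>" "\<alpha> < c" and \<beta>: "c < \<beta>" "\<beta> \<le> 1"
    and K: "hardy_bound p a K"
  shows "kfun p a \<alpha> \<beta> \<le> K powr p"
proof -
  have c0: "0 < c" "c < 1" using p a by (auto simp: c)
  define f where "f = (\<lambda>s. if s \<le> 1 then \<beta> * s powr (\<beta> - 1) else \<alpha> * s powr (\<alpha> - 1))"
  define d where "d = p * (\<beta> - 1) + a"
  define e where "e = p * (\<alpha> - 1) + a"
  \<comment> \<open>The condition \<alpha> < c < \<beta> is integrability of the two weighted
    powers, at infinity and at 0 respectively.\<close>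
  have d1: "d + 1 = p * (\<beta> - c)" and e1: "e + 1 = - (p * (c - \<alpha>))"
    using p by (auto simp: d_def e_def c field_simps)
  have de: "-1 < d" "e < -1"
  proof -
    have "0 < p * (\<beta> - c)" "0 < p * (c - \<alpha>)" using p \<alpha> \<beta> by auto
    then show "-1 < d" "e < -1" using d1 e1 by linarith+
  qed
  have f0: "0 \<le> f s" for s using c0 \<alpha> \<beta> by (simp add: f_def)
  have f_meas: "f \<in> borel_measurable borel" unfolding f_def by measurable
  have F: "hardy_op f t = (if t \<le> 1 then t powr (\<beta> - 1) else t powr (\<alpha> - 1))" if "0 < t" for t
  proof -
    have i: "(f has_integral (if t \<le> 1 then t powr \<beta> else t powr \<alpha>)) {0..t}"
      unfolding f_def using \<alpha> \<beta> c0 that by (intro has_integral_power_pieces) auto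
    have "(\<integral>\<^sup>+s. ennreal (indicator {0..t} s *\<^sub>R f s) \<partial>lborel) = (\<integral>\<^sup>+s. ennreal (f s) * indicator {0..t} s \<partial>lborel)"
      by (intro nn_integral_cong) (auto simp: indicator_def)
    also have "\<dots> = ennreal (if t \<le> 1 then t powr \<beta> else t powr \<alpha>)"
      using nn_integral_has_integral_lebesgue'[OF f0 i] .
    finally have "has_bochner_integral lborel (\<lambda>s. indicator {0..t} s *\<^sub>R f s) (if t \<le> 1 then t powr \<beta> else t powr \<alpha>)"
      using f0 f_meas by (intro has_bochner_integral_nn_integral) auto
    then have "(LINT s:{0..t}|lborel. f s) = (if t \<le> 1 then t powr \<beta> else t powr \<alpha>)"
      unfolding set_lebesgue_integral_def by (rule has_bochner_integral_integral_eq)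
    then show ?thesis
      using that by (simp add: hardy_op_def powr_diff)
  qed
  have Wf: "weighted_int p a f = ennreal (\<beta> powr p / (p * (\<beta> - c)) + \<alpha> powr p / (p * (c - \<alpha>)))"
  proof -
    have "weighted_int p a f = (\<integral>\<^sup>+t\<in>{0<..}. ennreal (if t \<le> 1 then \<beta> powr p * t powr d else \<alpha> powr p * t powr e) \<partial>lborel)"
      unfolding weighted_int_def using \<alpha> \<beta> c0
      by (intro nn_integral_cong) (auto simp: f_def d_def e_def indicator_def powr_mult powr_powr powr_add mult.commute)
    also have "\<dots> = ennreal (\<beta> powr p / (d + 1) + \<alpha> powr p / (- (e + 1)))"
      using de by (intro nn_integral_power_pieces) auto
    finally show ?thesis by (simp add: d1 e1)
  qed
  have Wd: "weighted_int p a (\<lambda>t. hardy_op f t - f t) = ennreal ((1 - \<beta>) powr p / (p * (\<beta> - c)) + (1 - \<alpha>) powr p / (p * (c - \<alpha>)))"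
  proof -
    have D: "\<bar>hardy_op f t - f t\<bar> powr p * t powr a = (if t \<le> 1 then (1 - \<beta>) powr p * t powr d else (1 - \<alpha>) powr p * t powr e)"
      if "0 < t" for t
    proof -
      have "hardy_op f t - f t = (if t \<le> 1 then (1 - \<beta>) * t powr (\<beta> - 1) else (1 - \<alpha>) * t powr (\<alpha> - 1))"
        using F[OF that] by (simp add: f_def algebra_simps)
      then show ?thesis
        using \<alpha> \<beta> c0 by (auto simp: abs_mult d_def e_def powr_mult powr_powr powr_add mult.commute)
    qed
    have "weighted_int p a (\<lambda>t. hardy_op f t - f t) = (\<integral>\<^sup>+t\<in>{0<..}. ennreal (if t \<le> 1 then (1 - \<beta>) powr p * t powr d else (1 - \<alpha>) powr p * t powr e) \<partial>lborel)"
      unfolding weighted_int_def by (intro nn_integral_cong) (simp add: D indicator_def)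
    also have "\<dots> = ennreal ((1 - \<beta>) powr p / (d + 1) + (1 - \<alpha>) powr p / (- (e + 1)))"
      using de by (intro nn_integral_power_pieces) auto
    finally show ?thesis by (simp add: d1 e1)
  qed
  \<comment> \<open>Each piece decreases because its exponent is at most 0; at 1 the function can
    only drop, from at least \<beta> to at most \<alpha>.\<close>
  have anti: "f y \<le> f x" if "0 < x" "x \<le> y" for x y
  proof -
    have "y powr (\<beta> - 1) \<le> x powr (\<beta> - 1)" "y powr (\<alpha> - 1) \<le> x powr (\<alpha> - 1)"
      using that \<alpha> \<beta> c0 by (auto intro!: powr_mono2')
    moreover have "\<alpha> * y powr (\<alpha> - 1) \<le> \<beta> * x powr (\<beta> - 1)" if "x \<le> 1" "1 < y"
    proof -
      have "y powr (\<alpha> - 1) \<le> 1" "1 \<le> x powr (\<beta> - 1)"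
        using that \<open>0 < x\<close> \<alpha> \<beta> c0 powr_mono2'[of "\<alpha> - 1" 1 y] powr_mono2'[of "\<beta> - 1" x 1] by auto
      then have "\<alpha> * y powr (\<alpha> - 1) \<le> \<alpha> * 1" "\<beta> * 1 \<le> \<beta> * x powr (\<beta> - 1)"
        using \<alpha> \<beta> c0 by (auto intro!: mult_left_mono simp del: mult_1_right)
      then show ?thesis using \<alpha> \<beta> by linarith
    qed
    ultimately show ?thesis
      using that \<alpha> \<beta> c0 by (auto simp: f_def mult_left_mono)
  qed
  have "f \<in> hardy_class p a"
    using f0 anti Wf by (auto simp: hardy_class_def monotone_on_def)
  then have "weighted_int p a (\<lambda>t. hardy_op f t - f t) \<le> ennreal (K powr p) * weighted_int p a f"
    using K by (auto simp: hardy_bound_def)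
  moreover have N0: "0 \<le> \<beta> powr p / (p * (\<beta> - c)) + \<alpha> powr p / (p * (c - \<alpha>))"
    using p \<alpha> \<beta> by auto
  ultimately have "(1 - \<beta>) powr p / (p * (\<beta> - c)) + (1 - \<alpha>) powr p / (p * (c - \<alpha>)) \<le> K powr p * (\<beta> powr p / (p * (\<beta> - c)) + \<alpha> powr p / (p * (c - \<alpha>)))"
    unfolding Wf Wd by (simp add: ennreal_le_iff flip: ennreal_mult)
  \<comment> \<open>This factor clears the denominators and leaves the numerator and the denominator
    of \<open>kfun\<close>.\<close>
  then have "(p * (\<beta> - c) * (c - \<alpha>)) * ((1 - \<beta>) powr p / (p * (\<beta> - c)) + (1 - \<alpha>) powr p / (p * (c - \<alpha>)))
    \<le> (p * (\<beta> - c) * (c - \<alpha>)) * (K powr p * (\<beta> powr p / (p * (\<beta> - c)) + \<alpha> powr p / (p * (c - \<alpha>))))"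
    using p \<alpha> \<beta> by (intro mult_left_mono) auto
  moreover have clear: "(p * (\<beta> - c) * (c - \<alpha>)) * (Y / (p * (\<beta> - c)) + X / (p * (c - \<alpha>))) = (\<beta> - c) * X + (c - \<alpha>) * Y" for X Y
  proof -
    have "\<beta> - c \<noteq> 0" "c - \<alpha> \<noteq> 0" "p \<noteq> 0" using p \<alpha> \<beta> by auto
    then show ?thesis by (simp add: distrib_left)
  qed
  ultimately have "(\<beta> - c) * (1 - \<alpha>) powr p + (c - \<alpha>) * (1 - \<beta>) powr p \<le> K powr p * ((\<beta> - c) * \<alpha> powr p + (c - \<alpha>) * \<beta> powr p)"
    by (simp only: mult.left_commute[of _ "K powr p"] clear)
  moreover have "0 < (\<beta> - c) * \<alpha> powr p + (c - \<alpha>) * \<beta> powr p"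
    using \<alpha> \<beta> c0 by (intro add_nonneg_pos) auto
  ultimately show ?thesis
    using \<alpha> \<beta> c0 unfolding kfun_def c[symmetric] by (simp add: pos_divide_le_eq abs_minus_commute)
qed

section \<open>The sharp constant\<close>

text \<open>\<open>LEAST\<close> on the reals is meaningful only if a minimum exists, so attainment
  and minimality travel together with the value.\<close>

definition sharp_hardy_const :: "real \<Rightarrow> real \<Rightarrow> real \<Rightarrow> bool" where
  "sharp_hardy_const p a M \<longleftrightarrow> hardy_bound p a (hardy_const p a) \<and>
     (\<forall>K. hardy_bound p a K \<longrightarrow> hardy_const p a \<le> K) \<and> hardy_const p a powr p = M"

lemma sharp_hardy_constI:
  fixes p a M \<mu> c :: real
  assumes p: "1 \<le> p" and a: "-1 < a" "a < p - 1" and c: "c = (p - 1 - a) / p"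
    and M: "0 \<le> M" "0 \<le> \<mu>"
    and line: "\<And>x. 0 \<le> x \<Longrightarrow> x \<le> 1 \<Longrightarrow> (1 - x) powr p \<le> M * x powr p + \<mu> * (c - x)"
    and lower: "\<And>K. hardy_bound p a K \<Longrightarrow> M \<le> K powr p"
  shows "sharp_hardy_const p a M"
proof -
  have pow: "(M powr (1 / p)) powr p = M" using p M by (simp add: powr_powr)
  have b: "hardy_bound p a (M powr (1 / p))"
    unfolding hardy_bound_def pow using hardy_class_bound[OF p a c line M] by auto
  have min: "M powr (1 / p) \<le> K" if "hardy_bound p a K" for K
  proof -
    have "0 \<le> K" using that by (simp add: hardy_bound_def)
    then have "M powr (1 / p) \<le> (K powr p) powr (1 / p)"
      using lower[OF that] M p by (intro powr_mono2) auto
    then show ?thesis using \<open>0 \<le> K\<close> p by (simp add: powr_powr)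
  qed
  have "hardy_const p a = M powr (1 / p)"
    unfolding hardy_const_def using b min by (rule Least_equality)
  then show ?thesis
    using b min pow by (simp add: sharp_hardy_const_def)
qed

lemma kfun_simps:
  assumes "c = (p - 1 - a) / p"
  shows "kfun p a 0 1 = (1 - c) / c"
    and "\<alpha> < 1 \<Longrightarrow> kfun p a \<alpha> 1 = (1 - c) * (1 - \<alpha>) powr p / ((1 - c) * \<bar>\<alpha>\<bar> powr p + (c - \<alpha>))"
    and "\<beta> \<le> 1 \<Longrightarrow> kfun p a 0 \<beta> = (c * (1 - \<beta>) powr p + (\<beta> - c)) / (c * \<bar>\<beta>\<bar> powr p)"
  unfolding kfun_def assms[symmetric] by (simp_all add: abs_minus_commute add.commute)

text \<open>The natural candidate t^(c-1) is not admissible: its weighted integrand is a multiple of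
  1 / t. It is approached by the test functions with \<alpha> = 0 as \<beta> decreases to c, where
  the weight \<beta> - c of the other piece tends to 0.\<close>

lemma hardy_bound_ge_ratio:
  fixes p a c K :: real
  assumes p: "1 \<le> p" and a: "-1 < a" "a < p - 1" and c: "c = (p - 1 - a) / p"
    and K: "hardy_bound p a K"
  shows "((1 - c) / c) powr p \<le> K powr p"
proof (rule tendsto_upperbound)
  have c0: "0 < c" "c < 1" using p a by (auto simp: c)
  have "((\<lambda>\<beta>. (c * (1 - \<beta>) powr p + (\<beta> - c)) / (c * \<bar>\<beta>\<bar> powr p))
     \<longlongrightarrow> (c * (1 - c) powr p + (c - c)) / (c * \<bar>c\<bar> powr p)) (at_right c)"
    using c0 by (intro tendsto_intros) auto
  moreover have "(c * (1 - c) powr p + (c - c)) / (c * \<bar>c\<bar> powr p) = ((1 - c) / c) powr p"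
    using c0 by (simp add: powr_divide)
  ultimately show "((\<lambda>\<beta>. (c * (1 - \<beta>) powr p + (\<beta> - c)) / (c * \<bar>\<beta>\<bar> powr p)) \<longlongrightarrow> ((1 - c) / c) powr p) (at_right c)"
    by simp
  show "\<forall>\<^sub>F \<beta> in at_right c. (c * (1 - \<beta>) powr p + (\<beta> - c)) / (c * \<bar>\<beta>\<bar> powr p) \<le> K powr p"
    using eventually_at_right_real[OF c0(2)]
  proof eventually_elim
    case (elim \<beta>)
    then show ?case
      using kfun_le_hardy_bound[OF p a c, of 0 \<beta> K] c0 K kfun_simps(3)[OF c, of \<beta>] by auto
  qed
qed simp

text \<open>The bound is attained by the indicator of (0, 1], the test function for \<alpha> = 0 and
  \<beta> = 1.\<close>

lemma sharp_hardy_const_chord: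
  fixes p a c :: real
  assumes p: "1 \<le> p" and a: "-1 < a" "a < p - 1" and c: "c = (p - 1 - a) / p"
    and line: "\<And>x. 0 \<le> x \<Longrightarrow> x \<le> 1 \<Longrightarrow> (1 - x) powr p \<le> (1 - c) / c * x powr p + 1 / c * (c - x)"
  shows "sharp_hardy_const p a ((1 - c) / c)"
proof (rule sharp_hardy_constI[OF p a c _ _ line])
  have c0: "0 < c" "c < 1" using p a by (auto simp: c)
  then show "0 \<le> (1 - c) / c" "0 \<le> 1 / c" by auto
  show "(1 - c) / c \<le> K powr p" if "hardy_bound p a K" for K
    using kfun_le_hardy_bound[OF p a c, of 0 1 K] c0 that kfun_simps(1)[OF c] by auto
qed

lemma sharp_hardy_const_ratio:
  fixes p a c :: real
  assumes p: "1 \<le> p" and a: "-1 < a" "a < p - 1" and c: "c = (p - 1 - a) / p"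
    and line: "\<And>x. 0 \<le> x \<Longrightarrow> x \<le> 1 \<Longrightarrow>
      (1 - x) powr p \<le> ((1 - c) / c) powr p * x powr p + p * (1 - c) powr (p - 1) / c * (c - x)"
  shows "sharp_hardy_const p a (((1 - c) / c) powr p)"
proof (rule sharp_hardy_constI[OF p a c _ _ line])
  have c0: "0 < c" "c < 1" using p a by (auto simp: c)
  then show "0 \<le> p * (1 - c) powr (p - 1) / c" using p by auto
qed (use hardy_bound_ge_ratio[OF p a c] in auto)

lemma is_alpha0_iff:
  assumes "1 \<le> p" "c = (p - 1 - a) / p"
  shows "is_alpha0 p a \<alpha> \<longleftrightarrow> \<alpha> \<in> {0<..<c} \<and> 1 + (p - 1) * \<alpha> - p * c - p * (1 - c) * \<alpha> powr (p - 1) = 0"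
proof -
  have a: "a = p * (1 - c) - 1" using assms by (simp add: field_simps)
  have "- (p - 1) * (1 - \<alpha>) + 1 + a - (1 + a) * \<alpha> powr (p - 1)
      = 1 + (p - 1) * \<alpha> - p * c - p * (1 - c) * \<alpha> powr (p - 1)"
    unfolding a by (simp add: algebra_simps)
  then show ?thesis unfolding is_alpha0_def assms(2)[symmetric] by (simp only:)
qed

lemma is_beta0_iff:
  assumes "1 \<le> p" "c = (p - 1 - a) / p"
  shows "is_beta0 p a \<beta> \<longleftrightarrow> \<beta> \<in> {c<..<1} \<and> p * c * (1 - \<beta>) powr (p - 1) + (p - 1) * \<beta> - p * c = 0"
proof -
  have pc: "p * c = p - 1 - a" using assms by (auto simp: field_simps)
  have "- (p - 1 - a) * (1 - \<beta>) powr (p - 1) - (p - 1) * \<beta> + p - 1 - a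
      = - (p * c * (1 - \<beta>) powr (p - 1) + (p - 1) * \<beta> - p * c)"
    unfolding pc by (simp add: algebra_simps)
  then show ?thesis unfolding is_beta0_def assms(2)[symmetric] by (simp only: neg_equal_0_iff_equal)
qed

text \<open>The tangency point serves both sides: the tangent through (1, -M) gives the upper bound,
  and the test function whose ratios f / Hf are 1 and then \<alpha> matches it. Uniqueness of the
  root is what makes \<open>alpha0\<close> denote it.\<close>

lemma sharp_hardy_const_alpha0:
  fixes p a c :: real
  assumes p: "1 < p" "p \<le> 2" and a: "-1 < a" "a < p - 1" and c: "c = (p - 1 - a) / p"
    and "p * c < 1" "1 < p * c powr (p - 1)"
  shows "\<exists>!\<alpha>. is_alpha0 p a \<alpha>" and "sharp_hardy_const p a (kfun p a (alpha0 p a) 1)"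
proof -
  have c0: "0 < c" "c < 1" using p a by (auto simp: c)
  show ex: "\<exists>!\<alpha>. is_alpha0 p a \<alpha>"
    using alpha_root_ex1[OF p c0] assms by (simp add: is_alpha0_iff[OF _ c])
  define \<alpha> where "\<alpha> = alpha0 p a"
  have "is_alpha0 p a \<alpha>"
    unfolding \<alpha>_def alpha0_def using ex by (rule theI')
  then have \<alpha>: "0 < \<alpha>" "\<alpha> < c"
    "1 + (p - 1) * \<alpha> - p * c - p * (1 - c) * \<alpha> powr (p - 1) = 0"
    using p by (auto simp: is_alpha0_iff[OF _ c])
  have k: "kfun p a \<alpha> 1 = (1 - c) * (1 - \<alpha>) powr p / ((1 - c) * \<alpha> powr p + (c - \<alpha>))"
    using kfun_simps(2)[OF c, of \<alpha>] \<alpha> c0 by simp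
  have k0: "0 \<le> kfun p a \<alpha> 1"
    unfolding k using \<alpha> c0 by (intro divide_nonneg_nonneg add_nonneg_nonneg mult_nonneg_nonneg) auto
  show "sharp_hardy_const p a (kfun p a (alpha0 p a) 1)"
    unfolding \<alpha>_def[symmetric]
  proof (rule sharp_hardy_constI[OF _ a c k0, where \<mu> = "kfun p a \<alpha> 1 / (1 - c)"])
    show "(1 - x) powr p \<le> kfun p a \<alpha> 1 * x powr p + kfun p a \<alpha> 1 / (1 - c) * (c - x)"
      if "0 \<le> x" "x \<le> 1" for x
      unfolding k using tangent_bound_le2[OF p \<alpha>(1,2) c0(2) \<alpha>(3) that] .
    show "kfun p a \<alpha> 1 \<le> K powr p" if "hardy_bound p a K" for K
      using kfun_le_hardy_bound[OF _ a c _ _ _ _ that, of \<alpha> 1] p \<alpha> c0 by auto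
  qed (use k0 c0 p in auto)
qed

lemma sharp_hardy_const_beta0:
  fixes p a c :: real
  assumes p: "2 \<le> p" and a: "-1 < a" "a < p - 1" and c: "c = (p - 1 - a) / p"
    and "c < 1 - 1 / p" "p * (1 - c) powr (p - 1) < 1"
  shows "\<exists>!\<beta>. is_beta0 p a \<beta>" and "sharp_hardy_const p a (kfun p a 0 (beta0 p a))"
proof -
  have c0: "0 < c" "c < 1" using p a by (auto simp: c)
  show ex: "\<exists>!\<beta>. is_beta0 p a \<beta>"
    using beta_root_ex1[OF p c0(1)] assms by (simp add: is_beta0_iff[OF _ c])
  define \<beta> where "\<beta> = beta0 p a"
  have "is_beta0 p a \<beta>"
    unfolding \<beta>_def beta0_def using ex by (rule theI')
  then have \<beta>: "c < \<beta>" "\<beta> < 1" "p * c * (1 - \<beta>) powr (p - 1) + (p - 1) * \<beta> - p * c = 0"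
    using p by (auto simp: is_beta0_iff[OF _ c])
  have k: "kfun p a 0 \<beta> = (c * (1 - \<beta>) powr p + (\<beta> - c)) / (c * \<beta> powr p)"
    using kfun_simps(3)[OF c, of \<beta>] \<beta> c0 by simp
  have k0: "0 \<le> kfun p a 0 \<beta>"
    unfolding k using \<beta> c0 by (intro divide_nonneg_nonneg add_nonneg_nonneg mult_nonneg_nonneg) auto
  show "sharp_hardy_const p a (kfun p a 0 (beta0 p a))"
    unfolding \<beta>_def[symmetric]
  proof (rule sharp_hardy_constI[OF _ a c k0, where \<mu> = "1 / c"])
    show "(1 - x) powr p \<le> kfun p a 0 \<beta> * x powr p + 1 / c * (c - x)" if "0 \<le> x" "x \<le> 1" for x
      unfolding k using tangent_bound_ge2[OF p c0(1) \<beta> that] .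
    show "kfun p a 0 \<beta> \<le> K powr p" if "hardy_bound p a K" for K
      using kfun_le_hardy_bound[OF _ a c _ _ _ _ that, of 0 \<beta>] p \<beta> c0 by auto
  qed (use c0 p in auto)
qed

theorem theorem2p2:
  fixes p a :: real
  assumes "1 \<le> p" and "-1 < a" and "a < p - 1"
  shows "hardy_bound p a (hardy_const p a)
    \<and> (\<forall>K. hardy_bound p a K \<longrightarrow> hardy_const p a \<le> K)
    \<and> (p = 1 \<longrightarrow> hardy_const p a powr p = (1 + a) / (- a))
    \<and> (1 < p \<and> p \<le> 2 \<and> p - 1 - p powr ((p - 2) / (p - 1)) \<le> a \<and> a < p - 1 \<longrightarrow>
         hardy_const p a powr p = ((1 + a) / (p - 1 - a)) powr p)
    \<and> (1 < p \<and> p \<le> 2 \<and> p - 2 < a \<and> a < p - 1 - p powr ((p - 2) / (p - 1)) \<longrightarrow>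
         (\<exists>!\<alpha>. is_alpha0 p a \<alpha>) \<and> hardy_const p a powr p = kfun p a (alpha0 p a) 1)
    \<and> (1 < p \<and> p \<le> 2 \<and> -1 < a \<and> a \<le> p - 2 \<longrightarrow>
         hardy_const p a powr p = (1 + a) / (p - 1 - a))
    \<and> (2 < p \<and> p powr ((p - 2) / (p - 1)) - 1 \<le> a \<and> a < p - 1 \<longrightarrow>
         hardy_const p a powr p = ((1 + a) / (p - 1 - a)) powr p)
    \<and> (2 < p \<and> 0 < a \<and> a < p powr ((p - 2) / (p - 1)) - 1 \<longrightarrow>
         (\<exists>!\<beta>. is_beta0 p a \<beta>) \<and> hardy_const p a powr p = kfun p a 0 (beta0 p a))
    \<and> (2 < p \<and> -1 < a \<and> a \<le> 0 \<longrightarrow>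
         hardy_const p a powr p = (1 + a) / (p - 1 - a))"
proof -
  define c where "c = (p - 1 - a) / p"
  note ha = assms(2,3) c_def
  have c0: "0 < c" "c < 1" using assms by (auto simp: c_def)
  have pc: "p * c = p - 1 - a" "p * (1 - c) = 1 + a"
    using assms by (auto simp: c_def field_simps)
  have "(1 - c) / c = p * (1 - c) / (p * c)" using assms by simp
  then have ratio: "(1 - c) / c = (1 + a) / (p - 1 - a)" by (simp only: pc)
  have one: "sharp_hardy_const p a ((1 + a) / (- a))" if "p = 1"
  proof -
    \<comment> \<open>For p = 1 the curve is itself a line on [0, 1], and the chord coincides with
      it.\<close>
    have "(1 - x) powr p \<le> (1 - c) / c * x powr p + 1 / c * (c - x)" if "0 \<le> x" "x \<le> 1" for x
      using c0 that \<open>p = 1\<close> by (simp add: field_simps)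
    from sharp_hardy_const_chord[OF assms(1) ha this] show ?thesis
      using ratio that by simp
  qed
  have ratio_le2: "sharp_hardy_const p a (((1 + a) / (p - 1 - a)) powr p)"
    if p: "1 < p" "p \<le> 2" and "p - 1 - p powr ((p - 2) / (p - 1)) \<le> a"
  proof -
    have "p * c powr (p - 1) \<le> 1"
      using that threshold_powr(1)[of p c] c0 by (simp add: pc)
    from sharp_hardy_const_ratio[OF assms(1) ha ratio_bound_le2[OF p c0 this]] show ?thesis
      by (simp add: ratio)
  qed
  have tangent_le2: "\<exists>!\<alpha>. is_alpha0 p a \<alpha>" "sharp_hardy_const p a (kfun p a (alpha0 p a) 1)"
    if p: "1 < p" "p \<le> 2" and "p - 2 < a" "a < p - 1 - p powr ((p - 2) / (p - 1))"
  proof -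
    have "p * c < 1" "1 < p * c powr (p - 1)"
      using that threshold_powr(1)[of p c] c0 by (auto simp: pc not_le)
    from sharp_hardy_const_alpha0[OF p ha this]
    show "\<exists>!\<alpha>. is_alpha0 p a \<alpha>" "sharp_hardy_const p a (kfun p a (alpha0 p a) 1)" .
  qed
  have chord_le2: "sharp_hardy_const p a ((1 + a) / (p - 1 - a))"
    if p: "1 < p" "p \<le> 2" and "a \<le> p - 2"
  proof -
    have "1 / p \<le> c" using that pc(1) by (simp add: pos_divide_le_eq mult.commute)
    from sharp_hardy_const_chord[OF assms(1) ha chord_bound_le2[OF p this c0(2)]] show ?thesis
      by (simp add: ratio)
  qed
  have ratio_ge2: "sharp_hardy_const p a (((1 + a) / (p - 1 - a)) powr p)"
    if p: "2 < p" and "p powr ((p - 2) / (p - 1)) - 1 \<le> a"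
  proof -
    have "1 \<le> p * (1 - c) powr (p - 1)"
      using that threshold_powr(2)[of p "1 - c"] c0 by (simp add: pc)
    from sharp_hardy_const_ratio[OF assms(1) ha ratio_bound_ge2[OF less_imp_le[OF p] c0 this]] show ?thesis
      by (simp add: ratio)
  qed
  have lt: "c < 1 - 1 / p \<longleftrightarrow> 0 < a" if "2 < p"
    using that by (simp add: c_def field_simps zero_less_mult_iff)
  have tangent_ge2: "\<exists>!\<beta>. is_beta0 p a \<beta>" "sharp_hardy_const p a (kfun p a 0 (beta0 p a))"
    if p: "2 < p" and "0 < a" "a < p powr ((p - 2) / (p - 1)) - 1"
  proof -
    have "c < 1 - 1 / p" "p * (1 - c) powr (p - 1) < 1"
      using that threshold_powr(2)[of p "1 - c"] c0 lt by (auto simp: pc not_le)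
    from sharp_hardy_const_beta0[OF less_imp_le[OF p] ha this]
    show "\<exists>!\<beta>. is_beta0 p a \<beta>" "sharp_hardy_const p a (kfun p a 0 (beta0 p a))" .
  qed
  have chord_ge2: "sharp_hardy_const p a ((1 + a) / (p - 1 - a))" if p: "2 < p" and "a \<le> 0"
  proof -
    have "1 - 1 / p \<le> c" using that lt by (simp flip: not_less)
    from sharp_hardy_const_chord[OF assms(1) ha chord_bound_ge2[OF less_imp_le[OF p] this c0(2)]] show ?thesis
      by (simp add: ratio)
  qed
  \<comment> \<open>Attainment and minimality are claimed without a case hypothesis, so the cases
    have to be shown exhaustive. They may overlap, as at p = 2 and a = 0.\<close>
  consider "p = 1" | "1 < p" "p \<le> 2" "p - 1 - p powr ((p - 2) / (p - 1)) \<le> a"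
    | "1 < p" "p \<le> 2" "p - 2 < a" "a < p - 1 - p powr ((p - 2) / (p - 1))"
    | "1 < p" "p \<le> 2" "a \<le> p - 2"
    | "2 < p" "p powr ((p - 2) / (p - 1)) - 1 \<le> a"
    | "2 < p" "0 < a" "a < p powr ((p - 2) / (p - 1)) - 1"
    | "2 < p" "a \<le> 0"
    using assms(1) by linarith
  then have "\<exists>M. sharp_hardy_const p a M"
    using one ratio_le2 tangent_le2(2) chord_le2 ratio_ge2 tangent_ge2(2) chord_ge2
    by cases blast+
  then show ?thesis
    using one ratio_le2 tangent_le2 chord_le2 ratio_ge2 tangent_ge2 chord_ge2
    by (auto simp: sharp_hardy_const_def)
qed

end
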